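(* Let $G=(V,E)$ be a graph with a decomposition $(A,C,B)$, and let $f:\mathbb{R}\to\mathbb{R}$. (1) If $f[-]$ preserves positivity on $\mathcal{P}_{G_{A\cup C}}$ and on $\mathcal{P}_{G_{B\cup C}}$, and is Loewner super-additive on $\mathcal{P}_{G_C}$, then $f[-]$ preserves positivity on $\mathcal{P}_G$. (2) Conversely, if $f=\psi_\alpha$ or $f=\phi_\alpha$ (for some $\alpha\in\mathbb{R}$) and $f[-]$ preserves positivity on $\mathcal{P}_G$, then $f[-]$ is Loewner super-additive on $\mathcal{P}_{G_{C'}}$ for every clique $C'\subset C$ for which there exist vertices $v_1\in A$, $v_2\in B$ that are adjacent to every $v\in C'$. In particular, when $f=\psi_\alpha$ or $f=\phi_\alpha$ and $|C|=1$, $f[-]$ preserves positivity on $\mathcal{P}_G$ if and only if $f[-]$ preserves positivity on $\mathcal{P}_{G_{A\cup C}}$ and $\mathcal{P}_{G_{B\cup C}}$ and is super-additive on $[0,\infty)$.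
   Context: All graphs are finite and simple. For $U\subset V$, $G_U$ is the subgraph of $G$ induced by $U$. A clique is a complete induced subgraph. $U\subset V$ separates $X$ from $Y$ if every path from a vertex of $X$ to a vertex of $Y$meets $U$. A decomposition of $G$ is a partition $(A,C,B)$ of $V$ such that $C$ separates $A$ from $B$ and $G_C$ is complete. For a graph $H$ on vertex set $\{1,\dots,n\}$, $\mathcal{P}_H=\mathcal{P}_H(\mathbb{R})$ is the set of real symmetric positive semidefinite $n\times n$ matrices $M$ with $m_{ij}=0$ whenever $i\ne j$ and $(i,j)$ is not an edge. For $f:\mathbb{R}\to\mathbb{R}$, $f[M]:=(f(m_{ij}))$ entrywise; $f[-]$ preserves positivity on $\mathcal{P}_H$ if $f[M]\in\mathcal{P}_H$ for all $M\in\mathcal{P}_H$. For $f$ with $f(0)=0$, $f[-]$ is Loewner super-additive on $\mathcal{P}_H$ if $f[M+N]-f[M]-f[N]\in\mathcal{P}_H$ for all $M,N\in\mathcal{P}_H$ (for $H$ a single vertex this is ordinary super-additivity on $[0,\infty)$). $\psi_\alpha(x)=\mathrm{sgn}(x)|x|^\alpha$, $\phi_\alpha(x)=|x|^\alpha$ for $x\neq0$, and $\psi_\alpha(0)=\phi_\alpha(0)=0$.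
   Formalization: The "in particular" claim is proved assuming the vertex of C has a neighbour in A and one in B, as in (2); without this it fails, e.g. for three isolated vertices and ψ_{1/2}, which preserves positivity on diagonal matrices but is not super-additive. *)

theory Defs
  imports Complex_Main
begin

definition simple_graph :: "'a set \<Rightarrow> ('a \<Rightarrow> 'a \<Rightarrow> bool) \<Rightarrow> bool" where
  "simple_graph V E \<longleftrightarrow> finite V \<and> (\<forall>x y. E x y \<longrightarrow> x \<in> V \<and> y \<in> V)
     \<and> (\<forall>x y. E x y \<longrightarrow> E y x) \<and> (\<forall>x. \<not> E x x)"

definition is_path :: "'a set \<Rightarrow> ('a \<Rightarrow> 'a \<Rightarrow> bool) \<Rightarrow> 'a list \<Rightarrow> bool" where
  "is_path V E xs \<longleftrightarrow> xs \<noteq> [] \<and> set xs \<subseteq> V \<and> (\<forall>i. Suc i < length xs \<longrightarrow> E (xs ! i) (xs ! Suc i))"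

definition separates :: "'a set \<Rightarrow> ('a \<Rightarrow> 'a \<Rightarrow> bool) \<Rightarrow> 'a set \<Rightarrow> 'a set \<Rightarrow> 'a set \<Rightarrow> bool" where
  "separates V E U X Y \<longleftrightarrow>
     (\<forall>xs. is_path V E xs \<and> hd xs \<in> X \<and> last xs \<in> Y \<longrightarrow> set xs \<inter> U \<noteq> {})"

definition is_complete :: "('a \<Rightarrow> 'a \<Rightarrow> bool) \<Rightarrow> 'a set \<Rightarrow> bool" where
  "is_complete E U \<longleftrightarrow> (\<forall>x\<in>U. \<forall>y\<in>U. x \<noteq> y \<longrightarrow> E x y)"

definition is_clique :: "'a set \<Rightarrow> ('a \<Rightarrow> 'a \<Rightarrow> bool) \<Rightarrow> 'a set \<Rightarrow> bool" where
  "is_clique V E U \<longleftrightarrow> U \<subseteq> V \<and> is_complete E U"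

definition decomposition :: "'a set \<Rightarrow> ('a \<Rightarrow> 'a \<Rightarrow> bool) \<Rightarrow> 'a set \<Rightarrow> 'a set \<Rightarrow> 'a set \<Rightarrow> bool" where
  "decomposition V E A C B \<longleftrightarrow>
     A \<union> C \<union> B = V \<and> A \<inter> C = {} \<and> A \<inter> B = {} \<and> C \<inter> B = {}
     \<and> separates V E C A B \<and> is_complete E C"

text \<open>Real symmetric positive semidefinite matrix indexed by the finite set U
  (entries outside U \<times> U are irrelevant).\<close>
definition psd_on :: "'a set \<Rightarrow> ('a \<Rightarrow> 'a \<Rightarrow> real) \<Rightarrow> bool" where
  "psd_on U M \<longleftrightarrow> (\<forall>i\<in>U. \<forall>j\<in>U. M i j = M j i)
     \<and> (\<forall>x :: 'a \<Rightarrow> real. 0 \<le> (\<Sum>i\<in>U. \<Sum>j\<in>U. x i * M i j * x j))"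

definition PG :: "('a \<Rightarrow> 'a \<Rightarrow> bool) \<Rightarrow> 'a set \<Rightarrow> ('a \<Rightarrow> 'a \<Rightarrow> real) set" where
  "PG E U = {M. psd_on U M \<and> (\<forall>i\<in>U. \<forall>j\<in>U. i \<noteq> j \<and> \<not> E i j \<longrightarrow> M i j = 0)}"

definition entrywise :: "(real \<Rightarrow> real) \<Rightarrow> ('a \<Rightarrow> 'a \<Rightarrow> real) \<Rightarrow> ('a \<Rightarrow> 'a \<Rightarrow> real)" where
  "entrywise f M = (\<lambda>i j. f (M i j))"

definition preserves_pos :: "(real \<Rightarrow> real) \<Rightarrow> ('a \<Rightarrow> 'a \<Rightarrow> bool) \<Rightarrow> 'a set \<Rightarrow> bool" where
  "preserves_pos f E U \<longleftrightarrow> (\<forall>M\<in>PG E U. entrywise f M \<in> PG E U)"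

text \<open>Loewner super-additivity (defined for f with f(0) = 0; this is part of the notion).\<close>
definition loewner_superadditive :: "(real \<Rightarrow> real) \<Rightarrow> ('a \<Rightarrow> 'a \<Rightarrow> bool) \<Rightarrow> 'a set \<Rightarrow> bool" where
  "loewner_superadditive f E U \<longleftrightarrow> f 0 = 0 \<and>
     (\<forall>M\<in>PG E U. \<forall>N\<in>PG E U.
        (\<lambda>i j. entrywise f (\<lambda>a b. M a b + N a b) i j - entrywise f M i j - entrywise f N i j) \<in> PG E U)"

definition psi :: "real \<Rightarrow> real \<Rightarrow> real" where
  "psi \<alpha> x = (if x = 0 then 0 else sgn x * \<bar>x\<bar> powr \<alpha>)"

definition phi :: "real \<Rightarrow> real \<Rightarrow> real" where
  "phi \<alpha> x = (if x = 0 then 0 else \<bar>x\<bar> powr \<alpha>)"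

end

theory Submission
  imports Defs
begin

text \<open>Eliminating the vertices of \<open>A\<close> one by one writes \<open>M \<in> PG E V\<close> as a sum of a matrix \<open>P\<close> supported
  on \<open>A \<union> C\<close> and a matrix \<open>Q\<close> supported on \<open>B \<union> C\<close>, both positive semidefinite; then \<open>f[M]\<close> is the sum of
  \<open>f[P]\<close>, \<open>f[Q]\<close> and the super-additivity defect of \<open>P\<close>, \<open>Q\<close> on \<open>C\<close>. Conversely, two vertices joined
  to the clique give super-additivity on rank-one matrices, and for a power function this forces the
  exponent to be at least the size \<open>n\<close> of the clique or an integer of the right parity. In the latter
  case \<open>f(x) = x\<^sup>k\<close> and the Schur product theorem applies; in the former, super-additivity for
  exponent \<open>\<alpha> \<ge> n\<close> follows by differentiation from Loewner monotonicity for exponent \<open>\<alpha> - 1\<close>, which in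
  turn follows from positivity for exponent \<open>\<alpha> - 2\<close>.\<close>

subsection \<open>Positive semidefinite matrices on a finite index set\<close>

definition qform :: "'a set \<Rightarrow> ('a \<Rightarrow> 'a \<Rightarrow> real) \<Rightarrow> ('a \<Rightarrow> real) \<Rightarrow> real" where
  "qform U M x = (\<Sum>i\<in>U. \<Sum>j\<in>U. x i * M i j * x j)"

lemma psd_on_iff:
  "psd_on U M \<longleftrightarrow> (\<forall>i\<in>U. \<forall>j\<in>U. M i j = M j i) \<and> (\<forall>x. 0 \<le> qform U M x)"
  by (simp add: psd_on_def qform_def)

lemma psd_on_sym: "psd_on U M \<Longrightarrow> i \<in> U \<Longrightarrow> j \<in> U \<Longrightarrow> M i j = M j i"
  by (simp add: psd_on_iff)

lemma psd_on_qform: "psd_on U M \<Longrightarrow> 0 \<le> qform U M x"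
  by (simp add: psd_on_iff)

lemma qform_cong:
  "(\<And>i j. i \<in> U \<Longrightarrow> j \<in> U \<Longrightarrow> M i j = N i j) \<Longrightarrow> qform U M x = qform U N x"
  unfolding qform_def by (intro sum.cong refl) simp

lemma psd_on_cong:
  "(\<And>i j. i \<in> U \<Longrightarrow> j \<in> U \<Longrightarrow> M i j = N i j) \<Longrightarrow> psd_on U M \<longleftrightarrow> psd_on U N"
  using qform_cong[of U M N] by (auto simp: psd_on_iff)

lemma qform_add: "qform U (\<lambda>i j. M i j + N i j) x = qform U M x + qform U N x"
  by (simp add: qform_def algebra_simps sum.distrib)

lemma qform_diff: "qform U (\<lambda>i j. M i j - N i j) x = qform U M x - qform U N x"
  by (simp add: qform_def algebra_simps sum_subtractf)

lemma qform_scale: "qform U (\<lambda>i j. c * M i j) x = c * qform U M x"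
  by (simp add: qform_def sum_distrib_left algebra_simps)

lemma qform_sum: "qform U (\<lambda>i j. \<Sum>k\<in>K. M k i j) x = (\<Sum>k\<in>K. qform U (M k) x)"
proof (cases "finite K")
  case True
  then show ?thesis
    by induction (simp_all add: qform_add, simp add: qform_def)
qed (simp add: qform_def)

lemma qform_rank1: "qform U (\<lambda>i j. w i * w j) x = (\<Sum>i\<in>U. x i * w i)\<^sup>2"
  by (simp add: qform_def power2_eq_square sum_product algebra_simps)

lemma psd_on_add: "psd_on U M \<Longrightarrow> psd_on U N \<Longrightarrow> psd_on U (\<lambda>i j. M i j + N i j)"
  by (simp add: psd_on_iff qform_add)

lemma psd_on_scale: "psd_on U M \<Longrightarrow> 0 \<le> c \<Longrightarrow> psd_on U (\<lambda>i j. c * M i j)"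
  by (simp add: psd_on_iff qform_scale)

lemma psd_on_rank1: "psd_on U (\<lambda>i j. w i * w j)"
  by (simp add: psd_on_iff qform_rank1)

lemma psd_on_sum: "(\<And>k. k \<in> K \<Longrightarrow> psd_on U (M k)) \<Longrightarrow> psd_on U (\<lambda>i j. \<Sum>k\<in>K. M k i j)"
  unfolding psd_on_iff qform_sum by (auto intro!: sum.cong sum_nonneg)

lemma qform_mono_neutral:
  assumes "finite U" "W \<subseteq> U"
    and "\<And>i j. i \<in> U \<Longrightarrow> j \<in> U \<Longrightarrow> i \<notin> W \<or> j \<notin> W \<Longrightarrow> x i * M i j * x j = 0"
  shows "qform U M x = qform W M x"
proof -
  have "qform U M x = (\<Sum>i\<in>W. \<Sum>j\<in>U. x i * M i j * x j)"
    unfolding qform_def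
    by (rule sum.mono_neutral_right) (use assms in \<open>auto intro!: sum.neutral\<close>)
  also have "\<dots> = qform W M x"
    unfolding qform_def
    by (intro sum.cong refl sum.mono_neutral_right) (use assms in auto)
  finally show ?thesis .
qed

lemma psd_on_subset:
  assumes "finite U" "W \<subseteq> U" "psd_on U M"
  shows "psd_on W M"
  unfolding psd_on_iff
proof (intro conjI ballI allI)
  show "M i j = M j i" if "i \<in> W" "j \<in> W" for i j
    using that assms psd_on_sym by (metis subsetD)
  fix x :: "'a \<Rightarrow> real"
  let ?y = "\<lambda>i. if i \<in> W then x i else 0"
  have "qform W M x = qform W M ?y"
    unfolding qform_def by (intro sum.cong refl) simp
  also have "\<dots> = qform U M ?y"
    by (rule qform_mono_neutral[symmetric]) (use assms in auto)
  finally show "0 \<le> qform W M x" using assms psd_on_qform by metis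
qed

lemma psd_on_extend:
  assumes "finite U" "W \<subseteq> U" "psd_on W M"
    and 0: "\<And>i j. i \<in> U \<Longrightarrow> j \<in> U \<Longrightarrow> i \<notin> W \<or> j \<notin> W \<Longrightarrow> M i j = 0"
  shows "psd_on U M"
  unfolding psd_on_iff
proof (intro conjI ballI allI)
  show "M i j = M j i" if "i \<in> U" "j \<in> U" for i j
    using that 0[of i j] 0[of j i] psd_on_sym[OF assms(3)] by metis
  show "0 \<le> qform U M x" for x
    using qform_mono_neutral[OF assms(1,2), of x M] 0 psd_on_qform[OF assms(3), of x] by simp
qed

lemma psd_on_zero_extend:
  assumes "finite U" "W \<subseteq> U" "psd_on W M"
  shows "psd_on U (\<lambda>i j. if i \<in> W \<and> j \<in> W then M i j else 0)"
proof (rule psd_on_extend[OF assms(1,2)])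
  show "psd_on W (\<lambda>i j. if i \<in> W \<and> j \<in> W then M i j else 0)"
    using assms(3) by (rule psd_on_cong[THEN iffD1, rotated]) simp
qed auto

section \<open>Elimination of vertices, Gram factorisations and Schur products\<close>

lemma qform_shift:
  assumes "finite U" "psd_on U M" "u \<in> U"
  shows "qform U M (x(u := x u + t)) =
    qform U M x + 2 * t * (\<Sum>j\<in>U. M u j * x j) + t\<^sup>2 * M u u"
proof -
  have sym: "M i u = M u i" if "i \<in> U" for i
    using psd_on_sym[OF assms(2) that assms(3)] .
  have upd: "x(u := x u + t) = (\<lambda>i. x i + (if i = u then t else 0))" by auto
  \<comment> \<open>Writing the cross terms as indicator sums over all of \<open>U\<close> lets the
    identity be checked term by term.\<close>
  have "qform U M (\<lambda>i. x i + (if i = u then t else 0)) = qform U M x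
      + (\<Sum>i\<in>U. \<Sum>j\<in>U. if j = u then t * (x i * M i u) else 0)
      + (\<Sum>i\<in>U. if i = u then (\<Sum>j\<in>U. t * M u j * x j) else 0)
      + (\<Sum>i\<in>U. \<Sum>j\<in>U. if j = u then (if i = u then t\<^sup>2 * M u u else 0) else 0)"
    unfolding qform_def sum.distrib[symmetric]
  proof (intro sum.cong refl, goal_cases)
    case (1 i)
    then show ?case
      by (cases "i = u") (auto simp: sum.distrib[symmetric] algebra_simps power2_eq_square
          intro!: sum.cong)
  qed
  also have "(\<Sum>i\<in>U. \<Sum>j\<in>U. if j = u then t * (x i * M i u) else 0) = t * (\<Sum>j\<in>U. M u j * x j)"
    using assms by (simp add: sum_distrib_left sym mult_ac cong: sum.cong)
  also have "(\<Sum>i\<in>U. if i = u then (\<Sum>j\<in>U. t * M u j * x j) else 0) = t * (\<Sum>j\<in>U. M u j * x j)"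
    using assms by (simp add: sum_distrib_left mult_ac)
  also have "(\<Sum>i\<in>U. \<Sum>j\<in>U. if j = u then (if i = u then t\<^sup>2 * M u u else 0) else 0) = t\<^sup>2 * M u u"
    using assms by simp
  finally show ?thesis unfolding upd by simp
qed

text \<open>One Cholesky step: \<open>w\<close> is column \<open>u\<close> divided by the root of
  its diagonal entry, and the remainder is the Schur complement padded with zeros. The last
  conclusion bounds the support of \<open>w\<close>, so that zero patterns can be tracked.\<close>

lemma psd_on_eliminate:
  assumes "finite U" "psd_on U M" "u \<in> U"
  obtains w where "psd_on U (\<lambda>i j. M i j - w i * w j)"
    "\<And>j. j \<in> U \<Longrightarrow> M u j = w u * w j"
    "\<And>i. M i u = 0 \<Longrightarrow> w i = 0"
proof -
  define m where "m = M u u"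
  define L where "L x = (\<Sum>j\<in>U. M u j * x j)" for x
  have quad: "0 \<le> qform U M x + 2 * t * L x + t\<^sup>2 * m" for x t
    using psd_on_qform[OF assms(2)] qform_shift[OF assms] by (metis L_def m_def)
  have sym: "M i j = M j i" if "i \<in> U" "j \<in> U" for i j
    using psd_on_sym[OF assms(2)] that .
  have m0: "0 \<le> m"
    using quad[of "\<lambda>_. 0" 1] by (simp add: L_def qform_def)
  \<comment> \<open>For \<open>m = 0\<close> the expression in \<open>quad\<close> is affine in
    \<open>t\<close>, so its slope must vanish; the chosen \<open>t\<close> would give it the value
    -1.\<close>
  have L0: "L x = 0" if "m = 0" for x
  proof (rule ccontr)
    assume "L x \<noteq> 0"
    then show False
      using quad[of x "- (qform U M x + 1) / (2 * L x)"] that by (simp add: field_simps)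
  qed
  have M0: "M u j = 0" if "m = 0" "j \<in> U" for j
    using L0[OF that(1), of "\<lambda>i. if i = j then 1 else 0"] assms(1) that(2)
    by (simp add: L_def if_distrib cong: if_cong)
  \<comment> \<open>If \<open>m = 0\<close>, division by zero yields \<open>w = 0\<close>, which is
    the right value because row \<open>u\<close> of \<open>M\<close> then vanishes.\<close>
  define w where "w i = M i u / sqrt m" for i
  have ww: "w i * w j = M i u * M j u / m" for i j
    using m0 by (simp add: w_def)
  show thesis
  proof
    show "psd_on U (\<lambda>i j. M i j - w i * w j)"
      unfolding psd_on_iff qform_diff qform_rank1
    proof (intro conjI ballI allI)
      show "M i j - w i * w j = M j i - w j * w i" if "i \<in> U" "j \<in> U" for i j
        using sym that by simp
      fix x
      have "(\<Sum>i\<in>U. x i * w i) = L x / sqrt m"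
        unfolding L_def w_def sum_divide_distrib
        by (intro sum.cong refl) (simp add: sym[OF _ assms(3)] mult.commute)
      then have "(\<Sum>i\<in>U. x i * w i)\<^sup>2 = (L x)\<^sup>2 / m"
        using m0 by (simp add: power_divide)
      \<comment> \<open>For positive \<open>m\<close>, evaluate \<open>quad\<close> at the minimiser
        \<open>t = - L x / m\<close>; for \<open>m = 0\<close> the left side is 0 by
        convention.\<close>
      moreover have "(L x)\<^sup>2 / m \<le> qform U M x"
      proof (cases "m = 0")
        case True
        then show ?thesis using psd_on_qform[OF assms(2)] by simp
      next
        case False
        then show ?thesis
          using quad[of x "- L x / m"] m0 by (simp add: field_simps power2_eq_square)
      qed
      ultimately show "0 \<le> qform U M x - (\<Sum>i\<in>U. x i * w i)\<^sup>2" by simp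
    qed
    show "M u j = w u * w j" if "j \<in> U" for j
      using M0[of j] that sym[of u j] assms(3) by (cases "m = 0") (auto simp: ww m_def)
    show "w i = 0" if "M i u = 0" for i
      using that by (simp add: w_def)
  qed
qed

text \<open>Repeated elimination. With \<open>S = U\<close> the second clause is a Gram
  factorisation of \<open>M\<close>. For one side of a separator the third clause keeps the
  eliminated part away from the other side.\<close>

lemma psd_on_eliminate_set:
  assumes "finite S" "finite U" "S \<subseteq> U" "psd_on U M"
  shows "\<exists>w. psd_on U (\<lambda>i j. M i j - (\<Sum>s\<in>S. w s i * w s j)) \<and>
    (\<forall>i\<in>S. \<forall>j\<in>U. M i j = (\<Sum>s\<in>S. w s i * w s j)) \<and>
    (\<forall>i\<in>U. (\<forall>s\<in>S. M i s = 0) \<longrightarrow> (\<forall>s\<in>S. w s i = 0))"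
  using assms(1,3)
proof (induction S)
  case empty
  then show ?case using assms by simp
next
  case (insert a S)
  then obtain w where w:
    "psd_on U (\<lambda>i j. M i j - (\<Sum>s\<in>S. w s i * w s j))"
    "\<And>i j. i \<in> S \<Longrightarrow> j \<in> U \<Longrightarrow> M i j = (\<Sum>s\<in>S. w s i * w s j)"
    "\<And>i s. i \<in> U \<Longrightarrow> \<forall>s\<in>S. M i s = 0 \<Longrightarrow> s \<in> S \<Longrightarrow> w s i = 0"
    by auto
  have aU: "a \<in> U" using insert by simp
  obtain v where v:
    "psd_on U (\<lambda>i j. M i j - (\<Sum>s\<in>S. w s i * w s j) - v i * v j)"
    "\<And>j. j \<in> U \<Longrightarrow> M a j - (\<Sum>s\<in>S. w s a * w s j) = v a * v j"
    "\<And>i. M i a - (\<Sum>s\<in>S. w s i * w s a) = 0 \<Longrightarrow> v i = 0"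
    using psd_on_eliminate[OF assms(2) w(1) aU] by blast
  define w' where "w' = w(a := v)"
  have sum': "(\<Sum>s\<in>insert a S. w' s i * w' s j) = v i * v j + (\<Sum>s\<in>S. w s i * w s j)" for i j
  proof -
    have "(\<Sum>s\<in>S. w' s i * w' s j) = (\<Sum>s\<in>S. w s i * w s j)"
      by (rule sum.cong) (use insert in \<open>auto simp: w'_def\<close>)
    then show ?thesis using insert by (simp add: w'_def)
  qed
  show ?case
  proof (intro exI[of _ w'] conjI ballI impI)
    show "psd_on U (\<lambda>i j. M i j - (\<Sum>s\<in>insert a S. w' s i * w' s j))"
      using v(1) by (simp add: sum' diff_diff_eq add.commute)
  next
    fix i j assume ij: "i \<in> insert a S" "j \<in> U"
    show "M i j = (\<Sum>s\<in>insert a S. w' s i * w' s j)"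
    proof (cases "i = a")
      case True
      then show ?thesis using v(2)[OF ij(2)] by (simp add: sum')
    next
      case False
      then have "i \<in> S" using ij by simp
      \<comment> \<open>Row \<open>i\<close> of the remainder is already zero, also at
        \<open>a\<close>, so eliminating \<open>a\<close> does not disturb the rows cleared
        before.\<close>
      then have "v i = 0" using v(3)[of i] w(2)[OF _ aU] by simp
      then show ?thesis using w(2)[OF \<open>i \<in> S\<close> ij(2)] by (simp add: sum')
    qed
  next
    fix i s assume *: "i \<in> U" "\<forall>s\<in>insert a S. M i s = 0" "s \<in> insert a S"
    then have "w s' i = 0" if "s' \<in> S" for s' using w(3)[of i s'] that by simp
    moreover from this have "v i = 0" using v(3)[of i] * by simp
    ultimately show "w' s i = 0" using * by (auto simp: w'_def)
  qed
qed

text \<open>A Gram factorisation of \<open>M\<close> turns the entrywise product into a sum of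
  congruences of \<open>N\<close> by diagonal matrices.\<close>

lemma psd_on_schur_product:
  assumes "finite U" "psd_on U M" "psd_on U N"
  shows "psd_on U (\<lambda>i j. M i j * N i j)"
proof -
  obtain w where w: "\<And>i j. i \<in> U \<Longrightarrow> j \<in> U \<Longrightarrow> M i j = (\<Sum>s\<in>U. w s i * w s j)"
    using psd_on_eliminate_set[OF assms(1,1) subset_refl assms(2)] by blast
  have "psd_on U (\<lambda>i j. w s i * w s j * N i j)" for s
    unfolding psd_on_iff
  proof (intro conjI ballI allI)
    show "w s i * w s j * N i j = w s j * w s i * N j i" if "i \<in> U" "j \<in> U" for i j
      using psd_on_sym[OF assms(3) that] by simp
    have "qform U (\<lambda>i j. w s i * w s j * N i j) x = qform U N (\<lambda>i. x i * w s i)" for x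
      by (simp add: qform_def mult_ac)
    then show "0 \<le> qform U (\<lambda>i j. w s i * w s j * N i j) x" for x
      using psd_on_qform[OF assms(3)] by simp
  qed
  then have "psd_on U (\<lambda>i j. \<Sum>s\<in>U. w s i * w s j * N i j)"
    by (intro psd_on_sum)
  then show ?thesis
    by (rule psd_on_cong[THEN iffD1, rotated]) (simp add: w sum_distrib_right)
qed

subsection \<open>The power functions\<close>

text \<open>The two families are carried together because differentiation interchanges them, up to
  the factor \<alpha>, while lowering the exponent by one.\<close>

definition is_power :: "real \<Rightarrow> (real \<Rightarrow> real) \<Rightarrow> bool" where
  "is_power \<alpha> f \<longleftrightarrow> f = psi \<alpha> \<or> f = phi \<alpha>"

lemma is_power_0 [simp]: "is_power \<alpha> f \<Longrightarrow> f 0 = 0"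
  by (auto simp: is_power_def psi_def phi_def)

lemma is_power_pos: "is_power \<alpha> f \<Longrightarrow> 0 < x \<Longrightarrow> f x = x powr \<alpha>"
  by (auto simp: is_power_def psi_def phi_def)

lemma is_power_1 [simp]: "is_power \<alpha> f \<Longrightarrow> f 1 = 1"
  by (simp add: is_power_pos)

lemma is_power_mult: "is_power \<alpha> f \<Longrightarrow> f (x * y) = f x * f y"
  by (auto simp: is_power_def psi_def phi_def abs_mult powr_mult sgn_mult)

lemma is_power_abs: "is_power \<alpha> f \<Longrightarrow> \<bar>f x\<bar> = \<bar>x\<bar> powr \<alpha>"
  by (auto simp: is_power_def psi_def phi_def abs_mult abs_sgn_eq)

lemma is_power_mono:
  assumes "is_power \<alpha> f" "0 < \<alpha>" "0 \<le> x" "x \<le> y"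
  shows "f x \<le> f y"
  using assms powr_mono2[of \<alpha> x y] by (auto simp: is_power_def psi_def phi_def)

lemma is_power_DERIV:
  assumes f: "is_power \<alpha> f" and \<alpha>: "1 < \<alpha>"
  obtains g where "is_power (\<alpha> - 1) g" "\<And>x. (f has_real_derivative \<alpha> * g x) (at x)"
proof -
  define g where "g = (if f = psi \<alpha> then phi (\<alpha> - 1) else psi (\<alpha> - 1))"
  have g: "is_power (\<alpha> - 1) g" by (simp add: g_def is_power_def)
  have "(f has_real_derivative \<alpha> * g x) (at x)" for x
  proof (cases x "0 :: real" rule: linorder_cases)
    case equal
    \<comment> \<open>This is the absolute value of the difference quotient of \<open>f\<close> at
      0.\<close>
    have "((\<lambda>h. \<bar>h\<bar> powr (\<alpha> - 1)) \<longlongrightarrow> 0) (at 0)"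
      using \<alpha> by (auto intro!: tendsto_eq_intros)
    then have "((\<lambda>h. \<bar>f h / h\<bar>) \<longlongrightarrow> 0) (at 0)"
      by (rule Lim_transform_eventually)
         (auto simp: eventually_at_filter is_power_abs[OF f] powr_diff)
    then have "((\<lambda>h. f h / h) \<longlongrightarrow> 0) (at 0)"
      by (rule tendsto_rabs_zero_cancel)
    then show ?thesis
      using equal f g by (simp add: has_field_derivative_iff)
  next
    case greater
    have "((\<lambda>y. y powr \<alpha>) has_real_derivative \<alpha> * x powr (\<alpha> - 1)) (at x)"
      using greater by (auto intro!: derivative_eq_intros)
    then have "(f has_real_derivative \<alpha> * x powr (\<alpha> - 1)) (at x)"
      by (rule has_field_derivative_transform_within_open[of _ _ _ "{0<..}"])
         (use greater is_power_pos[OF f] in auto)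
    then show ?thesis using is_power_pos[OF g greater] by simp
  next
    case less
    \<comment> \<open>The sign \<open>s\<close> handles both families at once on the negative axis;
      the chain rule accounts for the opposite sign in \<open>g\<close>.\<close>
    define s where "s = f (-1)"
    have s: "g (-1) = - s" "f y = s * (-y) powr \<alpha>" "g y = - s * (-y) powr (\<alpha> - 1)" if "y < 0" for y
      using that f by (auto simp: s_def is_power_def psi_def phi_def g_def)
    have "((\<lambda>y. s * (-y) powr \<alpha>) has_real_derivative - s * (\<alpha> * (-x) powr (\<alpha> - 1))) (at x)"
      using less by (auto intro!: derivative_eq_intros)
    then have "(f has_real_derivative - s * (\<alpha> * (-x) powr (\<alpha> - 1))) (at x)"
      by (rule has_field_derivative_transform_within_open[of _ _ _ "{..<0}"])
         (use less s in auto)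
    then show ?thesis using s(3)[OF less] by (simp add: mult_ac)
  qed
  with g show thesis using that by blast
qed

text \<open>Exponents decreasing to \<alpha> allow a strict lower bound on the exponent to be
  relaxed to a weak one.\<close>

lemma is_power_tendsto:
  assumes "is_power \<alpha> f"
  obtains F where "\<And>m. is_power (\<alpha> + 1 / real (Suc m)) (F m)" "\<And>x. (\<lambda>m. F m x) \<longlonglongrightarrow> f x"
proof
  define F where "F m = (if f = psi \<alpha> then psi (\<alpha> + 1 / real (Suc m)) else phi (\<alpha> + 1 / real (Suc m)))" for m
  show "is_power (\<alpha> + 1 / real (Suc m)) (F m)" for m
    by (simp add: F_def is_power_def)
  have lim: "(\<lambda>m. \<alpha> + 1 / real (Suc m)) \<longlonglongrightarrow> \<alpha> + 0"
    by (intro tendsto_add tendsto_const LIMSEQ_Suc lim_1_over_n)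
  have "(\<lambda>m. \<bar>x\<bar> powr (\<alpha> + 1 / real (Suc m))) \<longlonglongrightarrow> \<bar>x\<bar> powr \<alpha>" if "x \<noteq> 0" for x
    using that tendsto_powr[OF tendsto_const[of "\<bar>x\<bar>"] lim] by simp
  then have "(\<lambda>m. (if f = psi \<alpha> then sgn x else 1) * \<bar>x\<bar> powr (\<alpha> + 1 / real (Suc m)))
      \<longlonglongrightarrow> (if f = psi \<alpha> then sgn x else 1) * \<bar>x\<bar> powr \<alpha>" if "x \<noteq> 0" for x
    using that by (intro tendsto_mult tendsto_const)
  moreover have "(\<lambda>m. F m x) = (\<lambda>m. (if f = psi \<alpha> then sgn x else 1) * \<bar>x\<bar> powr (\<alpha> + 1 / real (Suc m)))"
    "f x = (if f = psi \<alpha> then sgn x else 1) * \<bar>x\<bar> powr \<alpha>" if "x \<noteq> 0" for x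
    using that assms by (auto simp: F_def is_power_def psi_def phi_def)
  moreover have "F m 0 = 0" "f 0 = 0" for m
    using assms by (auto simp: F_def psi_def phi_def)
  ultimately show "(\<lambda>m. F m x) \<longlonglongrightarrow> f x" for x
    by (cases "x = 0") simp_all
qed

section \<open>Positivity, monotonicity and super-additivity by differentiation\<close>

lemma DERIV_along_line:
  assumes "\<And>x. (f has_real_derivative f' x) (at x)"
  shows "((\<lambda>t. f (a + t * b)) has_real_derivative f' (a + t * b) * b) (at t)"
  by (rule DERIV_chain2[OF assms]) (auto intro!: derivative_eq_intros)

text \<open>For each fixed vector the quadratic form is nondecreasing along the path, since its
  derivative is the form of \<open>h'\<close>.\<close>

lemma psd_on_diff_derivative:
  fixes h :: "'a \<Rightarrow> 'a \<Rightarrow> real \<Rightarrow> real"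
  assumes sym: "\<And>i j t. i \<in> U \<Longrightarrow> j \<in> U \<Longrightarrow> h i j t = h j i t"
    and der: "\<And>i j t. i \<in> U \<Longrightarrow> j \<in> U \<Longrightarrow> (h i j has_real_derivative h' i j t) (at t)"
    and psd: "\<And>t. 0 \<le> t \<Longrightarrow> t \<le> 1 \<Longrightarrow> psd_on U (\<lambda>i j. h' i j t)"
  shows "psd_on U (\<lambda>i j. h i j 1 - h i j 0)"
  unfolding psd_on_iff
proof (intro conjI ballI allI)
  show "h i j 1 - h i j 0 = h j i 1 - h j i 0" if "i \<in> U" "j \<in> U" for i j
    using sym that by simp
  fix x
  have der': "((\<lambda>t. qform U (\<lambda>i j. h i j t) x) has_real_derivative
      qform U (\<lambda>i j. h' i j t) x) (at t)" for t
    unfolding qform_def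
    by (auto intro!: derivative_eq_intros der sum.cong)
  have "qform U (\<lambda>i j. h i j 0) x \<le> qform U (\<lambda>i j. h i j 1) x"
    by (rule DERIV_nonneg_imp_nondecreasing[of 0 1])
       (use der' psd_on_qform[OF psd] in auto)
  then show "0 \<le> qform U (\<lambda>i j. h i j 1 - h i j 0) x"
    by (simp add: qform_diff)
qed

text \<open>Both statements are proved together as in FitzGerald and Horn: splitting off a rank-one
  matrix reduces positivity to monotonicity on one index less, and differentiating reduces
  monotonicity to positivity for the exponent lowered by one.\<close>

lemma psd_on_power_insert:
  assumes fin: "finite W" "u \<notin> W" and \<alpha>: "0 < \<alpha>" and f: "is_power \<alpha> f"
    and mono: "\<And>M N. psd_on W M \<Longrightarrow> psd_on W N \<Longrightarrow>
        psd_on W (\<lambda>i j. f (N i j + M i j) - f (N i j))"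
    and M: "psd_on (insert u W) M"
  shows "psd_on (insert u W) (\<lambda>i j. f (M i j))"
proof -
  let ?U = "insert u W"
  have finU: "finite ?U" and uU: "u \<in> ?U" using fin by auto
  obtain w where w: "psd_on ?U (\<lambda>i j. M i j - w i * w j)"
    "\<And>j. j \<in> ?U \<Longrightarrow> M u j = w u * w j"
    using psd_on_eliminate[OF finU M uU] by blast
  \<comment> \<open>Monotonicity is used from the rank-one matrix up to \<open>M\<close>; their
    difference is the Schur complement.\<close>
  have "psd_on W (\<lambda>i j. f (w i * w j + (M i j - w i * w j)) - f (w i * w j))"
    by (rule mono[OF psd_on_subset[OF finU _ w(1)] psd_on_rank1]) auto
  then have "psd_on W (\<lambda>i j. f (M i j) - f (w i * w j))" by simp
  \<comment> \<open>In row and column \<open>u\<close> the matrix \<open>M\<close> agrees with the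
    rank-one matrix, so the difference vanishes there.\<close>
  then have "psd_on ?U (\<lambda>i j. f (M i j) - f (w i * w j))"
  proof (rule psd_on_extend[OF finU subset_insertI])
    fix i j assume ij: "i \<in> ?U" "j \<in> ?U" "i \<notin> W \<or> j \<notin> W"
    then consider "i = u" | "j = u" by auto
    then show "f (M i j) - f (w i * w j) = 0"
    proof cases
      case 1 then show ?thesis using w(2)[OF ij(2)] by simp
    next
      case 2 then show ?thesis using w(2)[OF ij(1)] psd_on_sym[OF M ij(1) uU] by (simp add: mult.commute)
    qed
  qed
  \<comment> \<open>By multiplicativity, the subtracted image is itself a rank-one positive matrix
    and can be added back.\<close>
  then have "psd_on ?U (\<lambda>i j. (f (M i j) - f (w i * w j)) + f (w i) * f (w j))"
    by (intro psd_on_add psd_on_rank1)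
  then show ?thesis by (simp add: is_power_mult[OF f])
qed

lemma psd_on_power_mono:
  assumes "finite U"
  shows "0 < \<alpha> \<Longrightarrow> real (card U) < \<alpha> + 1 \<Longrightarrow> is_power \<alpha> f \<Longrightarrow>
    psd_on U M \<Longrightarrow> psd_on U N \<Longrightarrow> psd_on U (\<lambda>i j. f (N i j + M i j) - f (N i j))"
  using assms
proof (induction U arbitrary: \<alpha> f M N)
  case empty
  then show ?case by (simp add: psd_on_def)
next
  case (insert u W)
  note f = \<open>is_power \<alpha> f\<close> and M = \<open>psd_on (insert u W) M\<close> and N = \<open>psd_on (insert u W) N\<close>
  show ?case
  proof (cases "W = {}")
    case True
    have "0 \<le> M u u" "0 \<le> N u u"
      using M N True psd_on_qform[of "{u}" _ "\<lambda>_. 1"] by (auto simp: qform_def)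
    then have "f (N u u) \<le> f (N u u + M u u)"
      using is_power_mono[OF f] insert.prems by simp
    then have "0 \<le> x * (f (N u u + M u u) - f (N u u)) * x" for x
      using mult_nonneg_nonneg[OF zero_le_square[of x], of "f (N u u + M u u) - f (N u u)"]
      by (simp add: mult_ac)
    then show ?thesis
      using True by (simp add: psd_on_def)
  next
    case False
    \<comment> \<open>At least two indices force \<alpha> above 1, so that \<open>f\<close> is
      differentiable at 0 as well.\<close>
    then have "1 \<le> card W" using insert.hyps by (simp add: Suc_le_eq card_gt_0_iff)
    then have \<alpha>: "1 < \<alpha>" "real (card W) < \<alpha>"
      using insert.hyps insert.prems by auto
    obtain g where g: "is_power (\<alpha> - 1) g" "\<And>x. (f has_real_derivative \<alpha> * g x) (at x)"
      using is_power_DERIV[OF f \<alpha>(1)] by blast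
    have "psd_on (insert u W) (\<lambda>i j. f (N i j + 1 * M i j) - f (N i j + 0 * M i j))"
    proof (rule psd_on_diff_derivative[where h' = "\<lambda>i j t. \<alpha> * (M i j * g (N i j + t * M i j))"])
      show "f (N i j + t * M i j) = f (N j i + t * M j i)"
        if "i \<in> insert u W" "j \<in> insert u W" for i j t
        using psd_on_sym[OF M that] psd_on_sym[OF N that] by simp
      show "((\<lambda>t. f (N i j + t * M i j)) has_real_derivative \<alpha> * (M i j * g (N i j + t * M i j))) (at t)"
        for i j t
        using DERIV_along_line[OF g(2), of "N i j" "M i j" t] by (simp add: mult_ac)
      fix t :: real assume t: "0 \<le> t" "t \<le> 1"
      \<comment> \<open>The induction hypothesis gives monotonicity on \<open>W\<close> for exponent
        \<open>\<alpha> - 1\<close>, as \<open>card W < (\<alpha> - 1) + 1\<close>; splitting off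
        \<open>u\<close> lifts this to positivity.\<close>
      have "psd_on (insert u W) (\<lambda>i j. g (N i j + t * M i j))"
        by (rule psd_on_power_insert[OF insert.hyps _ g(1) insert.IH])
           (use \<alpha> g t in \<open>auto intro!: psd_on_add psd_on_scale M N\<close>)
      then show "psd_on (insert u W) (\<lambda>i j. \<alpha> * (M i j * g (N i j + t * M i j)))"
        using insert.hyps \<alpha> by (intro psd_on_scale psd_on_schur_product M) auto
    qed
    then show ?thesis by simp
  qed
qed

text \<open>Differentiating f[N + tM] - f[tM] in t gives \<alpha> times the Schur product of
  \<open>M\<close> with a monotonicity increment for exponent \<open>\<alpha> - 1\<close>. The
  assumed bound on \<open>card U\<close> is the one monotonicity requires at that exponent.\<close>

lemma psd_on_power_superadditive_strict:
  assumes "finite U" "U \<noteq> {}" "real (card U) < \<alpha>" and f: "is_power \<alpha> f"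
    and M: "psd_on U M" and N: "psd_on U N"
  shows "psd_on U (\<lambda>i j. f (M i j + N i j) - f (M i j) - f (N i j))"
proof -
  have "1 \<le> card U" using assms by (simp add: Suc_le_eq card_gt_0_iff)
  then have \<alpha>: "1 < \<alpha>" using assms by simp
  obtain g where g: "is_power (\<alpha> - 1) g" "\<And>x. (f has_real_derivative \<alpha> * g x) (at x)"
    using is_power_DERIV[OF f \<alpha>] by blast
  have "psd_on U (\<lambda>i j. (f (N i j + 1 * M i j) - f (1 * M i j)) - (f (N i j + 0 * M i j) - f (0 * M i j)))"
  proof (rule psd_on_diff_derivative[where
        h' = "\<lambda>i j t. \<alpha> * (M i j * (g (t * M i j + N i j) - g (t * M i j)))"])
    show "f (N i j + t * M i j) - f (t * M i j) = f (N j i + t * M j i) - f (t * M j i)"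
      if "i \<in> U" "j \<in> U" for i j t
      using psd_on_sym[OF M that] psd_on_sym[OF N that] by simp
    show "((\<lambda>t. f (N i j + t * M i j) - f (t * M i j)) has_real_derivative
        \<alpha> * (M i j * (g (t * M i j + N i j) - g (t * M i j)))) (at t)" for i j t
      using DERIV_diff[OF DERIV_along_line[OF g(2), of "N i j" "M i j" t]
          DERIV_along_line[OF g(2), of 0 "M i j" t]]
      by (simp add: algebra_simps)
    fix t :: real assume t: "0 \<le> t" "t \<le> 1"
    show "psd_on U (\<lambda>i j. \<alpha> * (M i j * (g (t * M i j + N i j) - g (t * M i j))))"
      by (intro psd_on_scale psd_on_schur_product M psd_on_power_mono[OF _ _ _ g(1)] N)
         (use assms \<alpha> t in auto)
  qed
  then show ?thesis using f by (simp add: algebra_simps)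
qed

lemma psd_on_LIMSEQ:
  assumes "\<And>m. psd_on U (F m)" "\<And>i j. i \<in> U \<Longrightarrow> j \<in> U \<Longrightarrow> (\<lambda>m. F m i j) \<longlonglongrightarrow> M i j"
  shows "psd_on U M"
  unfolding psd_on_iff
proof (intro conjI ballI allI)
  show "M i j = M j i" if "i \<in> U" "j \<in> U" for i j
    using assms(2)[OF that] assms(2)[OF that(2,1)] psd_on_sym[OF assms(1) that]
    by (metis (no_types, lifting) LIMSEQ_unique ext)
  have "(\<lambda>m. qform U (F m) x) \<longlonglongrightarrow> qform U M x" for x
    unfolding qform_def by (intro tendsto_intros assms)
  then show "0 \<le> qform U M x" for x
    by (rule LIMSEQ_le_const) (use psd_on_qform[OF assms(1)] in auto)
qed

text \<open>The boundary case is a limit of the exponents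
  \<open>\<alpha> + 1 / real (Suc m)\<close>, which satisfy the strict bound.\<close>

lemma psd_on_power_superadditive:
  assumes "finite U" "U \<noteq> {}" "real (card U) \<le> \<alpha>" and f: "is_power \<alpha> f"
    and M: "psd_on U M" and N: "psd_on U N"
  shows "psd_on U (\<lambda>i j. f (M i j + N i j) - f (M i j) - f (N i j))"
proof -
  obtain F where F: "\<And>m. is_power (\<alpha> + 1 / real (Suc m)) (F m)" "\<And>x. (\<lambda>m. F m x) \<longlonglongrightarrow> f x"
    using is_power_tendsto[OF f] by blast
  show ?thesis
  proof (rule psd_on_LIMSEQ[where F = "\<lambda>m i j. F m (M i j + N i j) - F m (M i j) - F m (N i j)"])
    have "real (card U) < \<alpha> + 1 / real (Suc m)" for m
      using assms(3) by (rule le_less_trans) simp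
    then show "psd_on U (\<lambda>i j. F m (M i j + N i j) - F m (M i j) - F m (N i j))" for m
      using assms F(1) by (intro psd_on_power_superadditive_strict) auto
  qed (intro tendsto_diff F(2))
qed

text \<open>The defect for the next exponent is the old defect times M + N plus two mixed products,
  all of them Schur products of positive matrices.\<close>

lemma psd_on_natpower_superadditive:
  assumes "finite U" "psd_on U M" "psd_on U N"
  shows "psd_on U (\<lambda>i j. (M i j + N i j) ^ Suc k - M i j ^ Suc k - N i j ^ Suc k)"
proof (induction k)
  case 0
  show ?case by (simp add: psd_on_def)
next
  case (Suc k)
  have pow: "psd_on U (\<lambda>i j. L i j ^ Suc m)" if "psd_on U L" for L m
    by (induction m) (use that psd_on_schur_product[OF assms(1)] in auto)
  have "psd_on U (\<lambda>i j. ((M i j + N i j) ^ Suc k - M i j ^ Suc k - N i j ^ Suc k) * (M i j + N i j)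
      + (M i j ^ Suc k * N i j + N i j ^ Suc k * M i j))"
    using assms Suc.IH pow by (intro psd_on_add psd_on_schur_product)
  then show ?case
    by (rule psd_on_cong[THEN iffD1, rotated]) (simp add: algebra_simps)
qed

subsection \<open>Finite differences\<close>

text \<open>The iterated forward difference with unit step. It supplies test vectors: it annihilates
  the powers with exponent 0, ..., m - 1 and, at positive \<open>t\<close>, no other real
  power.\<close>

primrec fdiff :: "nat \<Rightarrow> (real \<Rightarrow> real) \<Rightarrow> real \<Rightarrow> real" where
  "fdiff 0 g t = g t"
| "fdiff (Suc m) g t = fdiff m g (t + 1) - fdiff m g t"

lemma fdiff_sum:
  "\<exists>c. c 0 \<noteq> 0 \<and> (\<forall>g t. fdiff m g t = (\<Sum>i\<le>m. c i * g (t + real i)))"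
proof (induction m)
  case 0
  show ?case by (rule exI[of _ "\<lambda>_. 1"]) simp
next
  case (Suc m)
  then obtain c where c: "c 0 \<noteq> 0" "\<And>g t. fdiff m g t = (\<Sum>i\<le>m. c i * g (t + real i))"
    by blast
  \<comment> \<open>Shifted coefficients minus old ones, as in Pascal's triangle. The case
    \<open>i = 0\<close> avoids truncated subtraction and makes \<open>d 0 = - c 0\<close>
    nonzero.\<close>
  define d where "d i = (if i = 0 then 0 else c (i - 1)) - (if i \<le> m then c i else 0)" for i
  have "fdiff (Suc m) g t = (\<Sum>i\<le>Suc m. d i * g (t + real i))" for g t
  proof -
    have "(\<Sum>i\<le>Suc m. d i * g (t + real i)) =
        (\<Sum>i\<le>Suc m. (if i = 0 then 0 else c (i - 1)) * g (t + real i))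
        - (\<Sum>i\<le>Suc m. (if i \<le> m then c i else 0) * g (t + real i))"
      by (simp only: d_def left_diff_distrib sum_subtractf)
    also have "(\<Sum>i\<le>Suc m. (if i = 0 then 0 else c (i - 1)) * g (t + real i)) = fdiff m g (t + 1)"
      by (subst sum.atMost_Suc_shift) (simp add: c(2) algebra_simps)
    also have "(\<Sum>i\<le>Suc m. (if i \<le> m then c i else 0) * g (t + real i)) = fdiff m g t"
      by (simp add: c(2))
    finally show ?thesis by simp
  qed
  moreover have "d 0 \<noteq> 0" using c(1) by (simp add: d_def)
  ultimately show ?case by blast
qed

text \<open>Transports the difference of order \<open>card U - 1\<close> to \<open>U\<close> by a
  bijection with its nodes. The index \<open>i0\<close> of the leftmost node is singled out for the
  parity argument, where only that node is negative.\<close>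

lemma fdiff_nodes:
  assumes "finite U" "U \<noteq> {}"
  obtains c v i0 where
    "\<And>g. (\<Sum>i\<in>U. c i * g (v i)) = fdiff (card U - 1) g t"
    "i0 \<in> U" "c i0 \<noteq> 0" "v i0 = t"
    "\<And>i. i \<in> U \<Longrightarrow> i \<noteq> i0 \<Longrightarrow> t + 1 \<le> v i"
    "\<And>i. i \<in> U \<Longrightarrow> v i \<le> t + real (card U) - 1"
proof -
  obtain m where m: "card U = Suc m" using assms by (metis card_gt_0_iff gr0_conv_Suc)
  obtain e where e: "bij_betw e U {..m}"
    using finite_same_card_bij[OF assms(1), of "{..m}"] m by auto
  obtain c where c: "c 0 \<noteq> 0" "\<And>g t. fdiff m g t = (\<Sum>i\<le>m. c i * g (t + real i))"
    using fdiff_sum by blast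
  obtain i0 where i0: "i0 \<in> U" "e i0 = 0" using e by (metis atMost_iff bij_betw_iff_bijections le0)
  show thesis
  proof (rule that[of "\<lambda>i. c (e i)" "\<lambda>i. t + real (e i)" i0])
    show "(\<Sum>i\<in>U. c (e i) * g (t + real (e i))) = fdiff (card U - 1) g t" for g
      using sum.reindex_bij_betw[OF e, of "\<lambda>i. c i * g (t + real i)"] by (simp add: c(2) m)
    show "t + 1 \<le> t + real (e i)" if "i \<in> U" "i \<noteq> i0" for i
    proof -
      have "e i \<noteq> 0" using that i0 bij_betw_imp_inj_on[OF e] by (metis inj_onD)
      then show ?thesis by simp
    qed
    show "t + real (e i) \<le> t + real (card U) - 1" if "i \<in> U" for i
      using bij_betw_apply[OF e that] by (simp add: m)
  qed (use i0 c in auto)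
qed

lemma fdiff_scale: "fdiff m (\<lambda>x. c * g x) t = c * fdiff m g t"
  by (induction m arbitrary: t) (simp_all add: right_diff_distrib)

lemma fdiff_DERIV:
  assumes "\<And>s. a \<le> s \<Longrightarrow> (g has_real_derivative g' s) (at s)"
  shows "a \<le> s \<Longrightarrow> (fdiff m g has_real_derivative fdiff m g' s) (at s)"
proof (induction m arbitrary: s)
  case 0
  then show ?case using assms by simp
next
  case (Suc m)
  have "((\<lambda>s. fdiff m g (s + 1)) has_real_derivative fdiff m g' (s + 1)) (at s)"
    using Suc.IH[of "s + 1"] Suc.prems by (simp add: DERIV_shift)
  then have "((\<lambda>s. fdiff m g (s + 1) - fdiff m g s) has_real_derivative
      fdiff m g' (s + 1) - fdiff m g' s) (at s)"
    by (intro DERIV_diff Suc)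
  then show ?case by (simp add: fun_eq_iff[symmetric])
qed

text \<open>The mean value theorem for \<open>fdiff m g\<close> on [t, t + 1] trades one difference
  for one derivative, so differences of powers can be found by induction on the order.\<close>

lemma fdiff_Suc_MVT:
  assumes "\<And>s. t \<le> s \<Longrightarrow> (g has_real_derivative g' s) (at s)"
  obtains s where "t < s" "fdiff (Suc m) g t = fdiff m g' s"
proof -
  have "\<exists>s. t < s \<and> s < t + 1 \<and>
      fdiff m g (t + 1) - fdiff m g t = (t + 1 - t) * fdiff m g' s"
    by (rule MVT2) (auto intro!: fdiff_DERIV[where a = t] assms)
  then show thesis using that by auto
qed

lemma fdiff_power: "k < m \<Longrightarrow> fdiff m (\<lambda>x. x ^ k) t = 0"
proof (induction k arbitrary: m t)
  case 0
  then obtain l where "m = Suc l" by (metis gr0_conv_Suc)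
  \<comment> \<open>The zero derivative is written as a product so that \<open>fdiff_scale\<close>
    pulls out the factor 0.\<close>
  obtain s where "fdiff (Suc l) (\<lambda>x. x ^ 0) t = fdiff l (\<lambda>x. 0 * 1) s"
    by (rule fdiff_Suc_MVT[of t "\<lambda>x. x ^ 0" "\<lambda>x. 0 * 1"]) auto
  then show ?case using \<open>m = Suc l\<close> fdiff_scale[of l 0 "\<lambda>_. 1" s] by simp
next
  case (Suc k)
  then obtain l where l: "m = Suc l" "k < l" by (metis Suc_less_eq2)
  have "((\<lambda>x. x ^ Suc k) has_real_derivative real (Suc k) * x ^ k) (at x)" for x :: real
    using DERIV_pow[of "Suc k" x] by simp
  then obtain s where "fdiff (Suc l) (\<lambda>x. x ^ Suc k) t = fdiff l (\<lambda>x. real (Suc k) * x ^ k) s"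
    by (rule fdiff_Suc_MVT)
  then show ?case using Suc.IH[OF l(2)] l(1) by (simp only: fdiff_scale)
qed

text \<open>Each mean value step contributes a factor \<beta>, \<beta> - 1, and so on, none of them
  zero by hypothesis; a power at a positive point remains.\<close>

lemma fdiff_powr_neq_0:
  "0 < t \<Longrightarrow> (\<And>k. k < m \<Longrightarrow> \<beta> \<noteq> real k) \<Longrightarrow> fdiff m (\<lambda>x. x powr \<beta>) t \<noteq> 0"
proof (induction m arbitrary: \<beta> t)
  case 0
  then show ?case by simp
next
  case (Suc m)
  obtain s where s: "t < s"
    "fdiff (Suc m) (\<lambda>x. x powr \<beta>) t = fdiff m (\<lambda>x. \<beta> * x powr (\<beta> - 1)) s"
    by (rule fdiff_Suc_MVT[of t "\<lambda>x. x powr \<beta>" "\<lambda>x. \<beta> * x powr (\<beta> - 1)"])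
       (use Suc.prems in \<open>auto intro!: derivative_eq_intros\<close>)
  have "\<beta> \<noteq> 0" using Suc.prems(2)[of 0] by simp
  moreover have "\<beta> - 1 \<noteq> real k" if "k < m" for k
    using Suc.prems(2)[of "Suc k"] that by auto
  ultimately show ?case
    using s Suc.IH[of s "\<beta> - 1"] Suc.prems(1) by (simp add: fdiff_scale)
qed

text \<open>Taylor expansion with Lagrange remainder. Since \<alpha> < n, the n-th derivative is
  largest in absolute value at 0, so one \<open>K\<close> serves all positive
  \<open>z\<close>.\<close>

lemma binomial_series_remainder:
  fixes \<alpha> :: real
  assumes "0 < n" "\<alpha> < real n"
  obtains b K where "b 0 = 1" "\<And>z. 0 < z \<Longrightarrow> \<bar>(1 + z) powr \<alpha> - (\<Sum>k<n. b k * z ^ k)\<bar> \<le> K * z ^ n"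
proof -
  define d where "d m t = (\<Prod>k<m. \<alpha> - real k) * (1 + t) powr (\<alpha> - real m)" for m t
  define b where "b m = d m 0 / fact m" for m
  show thesis
  proof (rule that[of b "\<bar>\<Prod>k<n. \<alpha> - real k\<bar> / fact n"])
    show "b 0 = 1" by (simp add: b_def d_def)
    fix z :: real assume z: "0 < z"
    have "\<exists>t. 0 < t \<and> t < z \<and>
       (1 + z) powr \<alpha> = (\<Sum>m<n. d m 0 / fact m * z ^ m) + d n t / fact n * z ^ n"
    proof (rule Maclaurin[OF z assms(1)])
      show "d 0 = (\<lambda>z. (1 + z) powr \<alpha>)" by (simp add: d_def fun_eq_iff)
      show "\<forall>m t. m < n \<and> 0 \<le> t \<and> t \<le> z \<longrightarrow> (d m has_real_derivative d (Suc m) t) (at t)"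
        unfolding d_def
        by (auto intro!: derivative_eq_intros simp: algebra_simps)
    qed
    then obtain t where t: "0 < t"
      "(1 + z) powr \<alpha> - (\<Sum>m<n. b m * z ^ m) = d n t / fact n * z ^ n"
      by (auto simp: b_def)
    have "(1 + t) powr (\<alpha> - real n) \<le> 1"
      using t assms(2) powr_mono[of "\<alpha> - real n" 0 "1 + t"] by simp
    then have "\<bar>d n t\<bar> \<le> \<bar>\<Prod>k<n. \<alpha> - real k\<bar>"
      by (simp add: d_def abs_mult mult_left_le)
    then show "\<bar>(1 + z) powr \<alpha> - (\<Sum>k<n. b k * z ^ k)\<bar> \<le> \<bar>\<Prod>k<n. \<alpha> - real k\<bar> / fact n * z ^ n"
      unfolding t(2) using z by (simp add: abs_mult divide_right_mono mult_right_mono)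
  qed
qed

subsection \<open>Power functions that are super-additive on rank-one matrices\<close>

text \<open>For multiplicative \<open>f\<close> the images of u u^T and v v^T are again of rank one,
  which is why their quadratic forms appear as squares.\<close>

definition rank1_superadditive :: "(real \<Rightarrow> real) \<Rightarrow> 'a set \<Rightarrow> bool" where
  "rank1_superadditive f U \<longleftrightarrow> (\<forall>u v x. (\<Sum>i\<in>U. x i * f (u i))\<^sup>2 + (\<Sum>i\<in>U. x i * f (v i))\<^sup>2
     \<le> qform U (\<lambda>i j. f (u i * u j + v i * v j)) x)"

text \<open>Take the all-ones vector for the first vector and scale \<open>v\<close> by the root of
  \<epsilon>; multiplicativity pulls the scaling out of \<open>f\<close>.\<close>

lemma rank1_superadditive_perturbation:
  assumes "rank1_superadditive f U" "is_power \<alpha> f" "0 < \<epsilon>"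
  shows "(\<Sum>i\<in>U. x i)\<^sup>2 + \<epsilon> powr \<alpha> * (\<Sum>i\<in>U. x i * f (v i))\<^sup>2
     \<le> qform U (\<lambda>i j. f (1 + \<epsilon> * (v i * v j))) x"
proof -
  have "(sqrt \<epsilon> * v i) * (sqrt \<epsilon> * v j) = (sqrt \<epsilon> * sqrt \<epsilon>) * (v i * v j)" for i j
    by (simp only: mult_ac)
  then have 1: "(sqrt \<epsilon> * v i) * (sqrt \<epsilon> * v j) = \<epsilon> * (v i * v j)" for i j
    using assms(3) by simp
  have "f (sqrt \<epsilon>) * f (sqrt \<epsilon>) = \<epsilon> powr \<alpha>"
    using assms(3) is_power_mult[OF assms(2), of "sqrt \<epsilon>" "sqrt \<epsilon>"]
    by (simp add: is_power_pos[OF assms(2)])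
  moreover have "(\<Sum>i\<in>U. x i * f (sqrt \<epsilon> * v i)) = f (sqrt \<epsilon>) * (\<Sum>i\<in>U. x i * f (v i))"
    by (simp add: is_power_mult[OF assms(2)] sum_distrib_left mult.left_commute)
  ultimately have 2: "(\<Sum>i\<in>U. x i * f (sqrt \<epsilon> * v i))\<^sup>2 = \<epsilon> powr \<alpha> * (\<Sum>i\<in>U. x i * f (v i))\<^sup>2"
    by (simp add: power_mult_distrib power2_eq_square)
  have "(\<Sum>i\<in>U. x i * f 1)\<^sup>2 + (\<Sum>i\<in>U. x i * f (sqrt \<epsilon> * v i))\<^sup>2
      \<le> qform U (\<lambda>i j. f (1 * 1 + (sqrt \<epsilon> * v i) * (sqrt \<epsilon> * v j))) x"
    using assms(1) unfolding rank1_superadditive_def by (elim allE)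
  then show ?thesis
    by (simp only: 1 2 is_power_1[OF assms(2)] mult_1_right)
qed

text \<open>Perturb the all-ones matrix by \<open>\<epsilon> v v\<^sup>T\<close> and test with a vector orthogonal to
  \<open>v, v\<^sup>2, \<dots>, v\<^sup>n\<^sup>-\<^sup>1\<close> but not to \<open>v\<^sup>\<alpha>\<close>: the quadratic form of the perturbed
  matrix is then \<open>O(\<epsilon>\<^sup>n)\<close> away from that of the all-ones matrix, too little to absorb \<open>\<epsilon>\<^sup>\<alpha>\<close>.\<close>

lemma rank1_superadditive_exponent:
  assumes "finite U" "U \<noteq> {}" "rank1_superadditive f U" "is_power \<alpha> f" "\<alpha> < real (card U)"
  shows "\<exists>k. 1 \<le> k \<and> k < card U \<and> \<alpha> = real k"
proof (rule ccontr)
  assume no: "\<not> ?thesis"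
  define n where "n = card U"
  have n: "0 < n" using assms by (simp add: n_def card_gt_0_iff)
  \<comment> \<open>Starting at 1 keeps all nodes positive, where \<open>f\<close> is
    \<open>powr\<close>.\<close>
  obtain c v i0 where cv: "\<And>g. (\<Sum>i\<in>U. c i * g (v i)) = fdiff (n - 1) g 1"
    "\<And>i. i \<in> U \<Longrightarrow> i \<noteq> i0 \<Longrightarrow> 1 + 1 \<le> v i" "v i0 = 1"
    unfolding n_def by (rule fdiff_nodes[OF assms(1,2), of 1]) blast
  have v: "0 < v i" if "i \<in> U" for i using cv(2,3) that by (cases "i = i0") force+
  \<comment> \<open>Dividing by the node shifts exponents by one: the annihilated powers become 1,
    ..., n - 1. Exponent 0 is left out because its term cancels against the all-ones matrix.\<close>
  define x where "x i = c i / v i" for i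
  have orth: "(\<Sum>i\<in>U. x i * v i ^ k) = 0" if "0 < k" "k < n" for k
  proof -
    have "(\<Sum>i\<in>U. x i * v i ^ k) = (\<Sum>i\<in>U. c i * v i ^ (k - 1))"
      using that v by (intro sum.cong) (auto simp: x_def power_eq_if less_imp_neq[symmetric])
    also have "\<dots> = 0"
      using cv(1)[of "\<lambda>y. y ^ (k - 1)"] fdiff_power[of "k - 1" "n - 1" 1] that by simp
    finally show ?thesis .
  qed
  define a where "a = (\<Sum>i\<in>U. x i * f (v i))"
  have "a = (\<Sum>i\<in>U. c i * v i powr (\<alpha> - 1))"
    unfolding a_def
  proof (intro sum.cong refl)
    fix i assume "i \<in> U"
    then show "x i * f (v i) = c i * v i powr (\<alpha> - 1)"
      using v[of i] by (simp add: x_def is_power_pos[OF assms(4)] powr_diff)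
  qed
  also have "\<dots> = fdiff (n - 1) (\<lambda>x. x powr (\<alpha> - 1)) 1" by (rule cv(1))
  also have "\<dots> \<noteq> 0"
  proof (rule fdiff_powr_neq_0)
    show "\<alpha> - 1 \<noteq> real k" if "k < n - 1" for k
    proof
      assume "\<alpha> - 1 = real k"
      then have "1 \<le> Suc k \<and> Suc k < card U \<and> \<alpha> = real (Suc k)"
        using that by (simp add: n_def)
      then show False using no by blast
    qed
  qed simp
  finally have a: "a \<noteq> 0" .
  obtain b K where b: "b 0 = 1"
    and K: "\<And>z. 0 < z \<Longrightarrow> \<bar>(1 + z) powr \<alpha> - (\<Sum>k<n. b k * z ^ k)\<bar> \<le> K * z ^ n"
    by (rule binomial_series_remainder[OF n assms(5)[folded n_def]]) blast
  define L where "L = (\<Sum>i\<in>U. \<Sum>j\<in>U. \<bar>x i\<bar> * (K * (v i * v j) ^ n) * \<bar>x j\<bar>)"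
  have bound: "a\<^sup>2 \<le> L * \<epsilon> powr (real n - \<alpha>)" if \<epsilon>: "0 < \<epsilon>" for \<epsilon>
  proof -
    define r where "r z = (1 + z) powr \<alpha> - (\<Sum>k<n. b k * z ^ k)" for z
    have "(\<Sum>i\<in>U. x i)\<^sup>2 + \<epsilon> powr \<alpha> * a\<^sup>2 \<le> qform U (\<lambda>i j. f (1 + \<epsilon> * (v i * v j))) x"
      unfolding a_def by (rule rank1_superadditive_perturbation[OF assms(3,4) \<epsilon>])
    also have "\<dots> = qform U (\<lambda>i j. (\<Sum>k<n. (b k * \<epsilon> ^ k) * (v i ^ k * v j ^ k)) + r (\<epsilon> * (v i * v j))) x"
    proof (rule qform_cong)
      fix i j assume "i \<in> U" "j \<in> U"
      then have "0 < 1 + \<epsilon> * (v i * v j)"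
        using v \<epsilon> by (intro add_pos_pos mult_pos_pos) auto
      then show "f (1 + \<epsilon> * (v i * v j)) =
          (\<Sum>k<n. (b k * \<epsilon> ^ k) * (v i ^ k * v j ^ k)) + r (\<epsilon> * (v i * v j))"
        by (simp add: is_power_pos[OF assms(4)] r_def power_mult_distrib mult_ac)
    qed
    also have "\<dots> = (\<Sum>k<n. (b k * \<epsilon> ^ k) * (\<Sum>i\<in>U. x i * v i ^ k)\<^sup>2) + qform U (\<lambda>i j. r (\<epsilon> * (v i * v j))) x"
      unfolding qform_add qform_sum qform_scale qform_rank1 ..
    \<comment> \<open>By orthogonality only the constant term survives, and it equals the first
      square on the left.\<close>
    also have "(\<Sum>k<n. (b k * \<epsilon> ^ k) * (\<Sum>i\<in>U. x i * v i ^ k)\<^sup>2) = (\<Sum>k\<in>{0}. (b k * \<epsilon> ^ k) * (\<Sum>i\<in>U. x i * v i ^ k)\<^sup>2)"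
      using n orth by (intro sum.mono_neutral_right) auto
    also have "\<dots> = (\<Sum>i\<in>U. x i)\<^sup>2" using b by simp
    also have "qform U (\<lambda>i j. r (\<epsilon> * (v i * v j))) x \<le> \<epsilon> ^ n * L"
      unfolding qform_def L_def sum_distrib_left
    proof (intro sum_mono)
      fix i j assume ij: "i \<in> U" "j \<in> U"
      have "\<bar>x i * r (\<epsilon> * (v i * v j)) * x j\<bar> = \<bar>x i\<bar> * \<bar>r (\<epsilon> * (v i * v j))\<bar> * \<bar>x j\<bar>"
        by (simp add: abs_mult)
      also have "\<dots> \<le> \<bar>x i\<bar> * (K * (\<epsilon> * (v i * v j)) ^ n) * \<bar>x j\<bar>"
        using K[of "\<epsilon> * (v i * v j)"] v ij \<epsilon>
        by (intro mult_right_mono mult_left_mono) (auto simp: r_def)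
      finally show "x i * r (\<epsilon> * (v i * v j)) * x j \<le> \<epsilon> ^ n * (\<bar>x i\<bar> * (K * (v i * v j) ^ n) * \<bar>x j\<bar>)"
        by (simp add: power_mult_distrib mult_ac)
    qed
    finally have "\<epsilon> powr \<alpha> * a\<^sup>2 \<le> \<epsilon> powr real n * L" using \<epsilon> by (simp add: powr_realpow)
    then show ?thesis using \<epsilon> by (simp add: powr_diff field_simps)
  qed
  have "((\<lambda>\<epsilon>. L * \<epsilon> powr (real n - \<alpha>)) \<longlongrightarrow> L * 0) (at_right 0)"
    using assms(5) unfolding n_def
    by (intro tendsto_mult tendsto_const) (auto intro!: tendsto_eq_intros simp: eventually_at_filter)
  then have "a\<^sup>2 \<le> L * 0"
    by (rule tendsto_lowerbound) (auto simp: eventually_at_filter bound)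
  then show False using a by simp
qed

text \<open>Parity decides: \<open>psi\<close> with odd \<open>k\<close> and \<open>phi\<close> with
  even \<open>k\<close> are the polynomial, the other two carry an extra sign.\<close>

lemma is_power_nat_cases:
  assumes "is_power (real k) f" "0 < k"
  shows "(\<forall>x. f x = x ^ k) \<or> (\<forall>x. f x = sgn x * x ^ k)"
proof -
  have "\<bar>x\<bar> powr real k = (if even k then x ^ k else sgn x * x ^ k)"
    "sgn x * \<bar>x\<bar> powr real k = (if even k then sgn x * x ^ k else x ^ k)" if "x \<noteq> 0" for x :: real
    using that assms(2) by (cases "0 < x"; auto simp: powr_realpow power_minus_odd)+
  note pow = this
  consider "f = psi (real k)" "even k" | "f = psi (real k)" "odd k"
    | "f = phi (real k)" "even k" | "f = phi (real k)" "odd k"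
    using assms(1) by (auto simp: is_power_def)
  then show ?thesis
  proof cases
    case 1
    then have "\<forall>x. f x = sgn x * x ^ k" using pow(2) by (auto simp: psi_def)
    then show ?thesis ..
  next
    case 2
    then have "\<forall>x. f x = x ^ k" using pow(2) assms(2) by (auto simp: psi_def)
    then show ?thesis ..
  next
    case 3
    then have "\<forall>x. f x = x ^ k" using pow(1) assms(2) by (auto simp: phi_def)
    then show ?thesis ..
  next
    case 4
    then have "\<forall>x. f x = sgn x * x ^ k" using pow(1) by (auto simp: phi_def)
    then show ?thesis ..
  qed
qed

text \<open>Here exactly one coordinate of the perturbing vector is negative. The wrong parity changes the
  value of the functional annihilating \<open>v\<^sup>k\<close> by that one term.\<close>

lemma rank1_superadditive_parity:
  assumes "finite U" "rank1_superadditive f U" "is_power (real k) f" "1 \<le> k" "k < card U"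
  shows "f x = x ^ k"
proof (rule ccontr)
  assume "f x \<noteq> x ^ k"
  then have f: "f x = sgn x * x ^ k" for x
    using is_power_nat_cases[OF assms(3)] assms(4) by auto
  define n where "n = card U"
  have n: "k < n" using assms by (simp add: n_def)
  have "U \<noteq> {}" using assms by auto
  \<comment> \<open>Starting at -1/2 makes exactly one node negative and none zero.\<close>
  then obtain c v i0 where cv: "\<And>g. (\<Sum>i\<in>U. c i * g (v i)) = fdiff (n - 1) g (-1/2)"
    "i0 \<in> U" "c i0 \<noteq> 0" "v i0 = -1/2"
    "\<And>i. i \<in> U \<Longrightarrow> i \<noteq> i0 \<Longrightarrow> -1/2 + 1 \<le> v i"
    "\<And>i. i \<in> U \<Longrightarrow> v i \<le> -1/2 + real n - 1"
    unfolding n_def by (rule fdiff_nodes[OF assms(1), of "-1/2"]) blast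
  have v0: "v i \<noteq> 0" "-1/2 \<le> v i" if "i \<in> U" for i
    using cv(4,5) that by (cases "i = i0"; force)+
  define x where "x i = c i / v i" for i
  have orth: "(\<Sum>i\<in>U. x i * v i ^ l) = 0" if "0 < l" "l < n" for l
  proof -
    have "(\<Sum>i\<in>U. x i * v i ^ l) = (\<Sum>i\<in>U. c i * v i ^ (l - 1))"
      using that v0 by (intro sum.cong) (auto simp: x_def power_eq_if)
    also have "\<dots> = 0"
      using cv(1)[of "\<lambda>y. y ^ (l - 1)"] fdiff_power[of "l - 1" "n - 1" "-1/2"] that by simp
    finally show ?thesis .
  qed
  \<comment> \<open>Small enough that every \<open>1 + \<epsilon> * (v i * v j)\<close> is positive,
    where the wrong-parity \<open>f\<close> still agrees with the polynomial.\<close>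
  define \<epsilon> where "\<epsilon> = 1 / real n"
  have \<epsilon>: "0 < \<epsilon>" using n by (simp add: \<epsilon>_def)
  have "(\<Sum>i\<in>U. x i)\<^sup>2 + \<epsilon> powr k * (\<Sum>i\<in>U. x i * f (v i))\<^sup>2 \<le> qform U (\<lambda>i j. f (1 + \<epsilon> * (v i * v j))) x"
    by (rule rank1_superadditive_perturbation[OF assms(2,3) \<epsilon>])
  also have "\<dots> = qform U (\<lambda>i j. \<Sum>l\<le>k. (real (k choose l) * \<epsilon> ^ l) * (v i ^ l * v j ^ l)) x"
  proof (rule qform_cong)
    fix i j assume ij: "i \<in> U" "j \<in> U"
    \<comment> \<open>Together with the upper bound n - 3/2 on the nodes this gives 4 v_i v_j \<ge>
      5 - 4n.\<close>
    have "0 \<le> (2 * v i + 1) * (2 * v j + 1)"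
      using v0(2)[OF ij(1)] v0(2)[OF ij(2)] by (intro mult_nonneg_nonneg) simp_all
    also have "\<dots> = 4 * (v i * v j) + 2 * v i + 2 * v j + 1" by (simp add: algebra_simps)
    finally have "0 \<le> 4 * (v i * v j) + 2 * v i + 2 * v j + 1" .
    moreover have "2 * v i \<le> 2 * real n - 3" "2 * v j \<le> 2 * real n - 3"
      using cv(6)[OF ij(1)] cv(6)[OF ij(2)] by simp_all
    ultimately have "- real n < v i * v j" by linarith
    then have "\<epsilon> * (- real n) < \<epsilon> * (v i * v j)"
      using \<epsilon> by (rule mult_strict_left_mono)
    moreover have "\<epsilon> * (- real n) = -1" using n by (simp add: \<epsilon>_def)
    ultimately have "0 < 1 + \<epsilon> * (v i * v j)" by simp
    then have "f (1 + \<epsilon> * (v i * v j)) = (\<epsilon> * (v i * v j) + 1) ^ k" by (simp add: f add.commute)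
    also have "\<dots> = (\<Sum>l\<le>k. (real (k choose l) * \<epsilon> ^ l) * (v i ^ l * v j ^ l))"
      unfolding binomial_ring by (simp add: power_mult_distrib mult_ac)
    finally show "f (1 + \<epsilon> * (v i * v j)) = (\<Sum>l\<le>k. (real (k choose l) * \<epsilon> ^ l) * (v i ^ l * v j ^ l))" .
  qed
  also have "\<dots> = (\<Sum>l\<le>k. (real (k choose l) * \<epsilon> ^ l) * (\<Sum>i\<in>U. x i * v i ^ l)\<^sup>2)"
    unfolding qform_sum qform_scale qform_rank1 ..
  also have "\<dots> = (\<Sum>l\<in>{0}. (real (k choose l) * \<epsilon> ^ l) * (\<Sum>i\<in>U. x i * v i ^ l)\<^sup>2)"
    using n orth by (intro sum.mono_neutral_right) auto
  also have "\<dots> = (\<Sum>i\<in>U. x i)\<^sup>2" by simp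
  finally have "(\<Sum>i\<in>U. x i * f (v i)) = 0" using \<epsilon> by (simp add: mult_le_0_iff)
  \<comment> \<open>Up to the sign at \<open>i0\<close> this is the difference of a polynomial of
    too low a degree, hence zero; the sign change leaves a nonzero multiple of
    \<open>c i0\<close>.\<close>
  also have "(\<Sum>i\<in>U. x i * f (v i)) =
      (\<Sum>i\<in>U. c i * v i ^ (k - 1) - (if i = i0 then 2 * (c i * v i ^ (k - 1)) else 0))"
  proof (intro sum.cong refl)
    fix i assume i: "i \<in> U"
    have "x i * f (v i) = sgn (v i) * (c i * v i ^ (k - 1))"
      using v0(1)[OF i] assms(4) by (simp add: x_def f power_eq_if)
    moreover have "sgn (v i) = (if i = i0 then -1 else 1)"
      using cv(4) cv(5)[OF i] by auto
    ultimately show "x i * f (v i) =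
        c i * v i ^ (k - 1) - (if i = i0 then 2 * (c i * v i ^ (k - 1)) else 0)"
      by simp
  qed
  also have "\<dots> = (\<Sum>i\<in>U. c i * v i ^ (k - 1)) - 2 * (c i0 * v i0 ^ (k - 1))"
    using assms(1) cv(2) by (simp add: sum_subtractf)
  also have "(\<Sum>i\<in>U. c i * v i ^ (k - 1)) = 0"
    using cv(1)[of "\<lambda>y. y ^ (k - 1)"] fdiff_power[of "k - 1" "n - 1" "-1/2"] n assms(4) by simp
  finally show False using cv(3,4) by simp
qed

lemma rank1_superadditive_imp_superadditive:
  assumes "finite U" "rank1_superadditive f U" "is_power \<alpha> f" "psd_on U M" "psd_on U N"
  shows "psd_on U (\<lambda>i j. f (M i j + N i j) - f (M i j) - f (N i j))"
proof -
  consider "U = {}" | "U \<noteq> {}" "real (card U) \<le> \<alpha>" | "U \<noteq> {}" "\<alpha> < real (card U)"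
    by linarith
  then show ?thesis
  proof cases
    case 1
    then show ?thesis by (simp add: psd_on_def)
  next
    case 2
    then show ?thesis using assms by (intro psd_on_power_superadditive)
  next
    case 3
    then obtain k where k: "1 \<le> k" "k < card U" "\<alpha> = real k"
      using rank1_superadditive_exponent assms by blast
    then have "f x = x ^ Suc (k - 1)" for x
      using rank1_superadditive_parity assms by force
    then show ?thesis
      using psd_on_natpower_superadditive[OF assms(1,4,5), of "k - 1"] by (simp only:)
  qed
qed

subsection \<open>Gluing along a separating clique\<close>

lemma PG_iff: "M \<in> PG E U \<longleftrightarrow> psd_on U M \<and> (\<forall>i\<in>U. \<forall>j\<in>U. i \<noteq> j \<and> \<not> E i j \<longrightarrow> M i j = 0)"
  by (simp add: PG_def)

lemma PG_complete: "is_complete E U \<Longrightarrow> M \<in> PG E U \<longleftrightarrow> psd_on U M"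
  by (auto simp: PG_iff is_complete_def)

lemma is_complete_subset: "is_complete E U \<Longrightarrow> W \<subseteq> U \<Longrightarrow> is_complete E W"
  unfolding is_complete_def by blast

lemma preserves_pos_iff:
  assumes "f 0 = 0"
  shows "preserves_pos f E U \<longleftrightarrow> (\<forall>M\<in>PG E U. psd_on U (\<lambda>i j. f (M i j)))"
  using assms by (auto simp: preserves_pos_def entrywise_def PG_iff)

lemma loewner_superadditive_complete:
  assumes "f 0 = 0" "is_complete E U"
  shows "loewner_superadditive f E U \<longleftrightarrow>
    (\<forall>M N. psd_on U M \<longrightarrow> psd_on U N \<longrightarrow> psd_on U (\<lambda>i j. f (M i j + N i j) - f (M i j) - f (N i j)))"
  using assms by (auto simp: loewner_superadditive_def entrywise_def PG_complete)

lemma separates_no_edge: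
  assumes "simple_graph V E" "decomposition V E A C B" "a \<in> A" "b \<in> B"
  shows "\<not> E a b" "\<not> E b a"
proof -
  show "\<not> E a b"
  proof
    assume "E a b"
    then have "is_path V E [a, b]"
      using assms by (auto simp: is_path_def decomposition_def)
    then have "set [a, b] \<inter> C \<noteq> {}"
      using assms(2-4) unfolding decomposition_def separates_def by (metis last_ConsL last_ConsR list.sel(1) list.distinct(1))
    then show False using assms by (auto simp: decomposition_def)
  qed
  then show "\<not> E b a" using assms(1) by (auto simp: simple_graph_def)
qed

lemma preserves_pos_glue:
  assumes G: "simple_graph V E" and D: "decomposition V E A C B"
    and A: "preserves_pos f E (A \<union> C)" and B: "preserves_pos f E (B \<union> C)"
    and C: "loewner_superadditive f E C"
  shows "preserves_pos f E V"
proof -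
  have V: "V = A \<union> C \<union> B" and disj: "A \<inter> C = {}" "A \<inter> B = {}" "C \<inter> B = {}" and compl: "is_complete E C"
    using D by (auto simp: decomposition_def)
  have fin: "finite V" using G by (simp add: simple_graph_def)
  have f0: "f 0 = 0" using C by (simp add: loewner_superadditive_def)
  note C = C[unfolded loewner_superadditive_complete[where f = f, OF f0 compl], rule_format]
  note A = A[unfolded preserves_pos_iff[where f = f, OF f0], rule_format]
  note B = B[unfolded preserves_pos_iff[where f = f, OF f0], rule_format]
  have "psd_on V (\<lambda>i j. f (M i j))" if M: "M \<in> PG E V" for M
  proof -
    have psdM: "psd_on V M" and M0: "\<And>i j. i \<in> V \<Longrightarrow> j \<in> V \<Longrightarrow> i \<noteq> j \<Longrightarrow> \<not> E i j \<Longrightarrow> M i j = 0"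
      using M by (auto simp: PG_iff)
    have MAB: "M i j = 0" "M j i = 0" if "i \<in> A" "j \<in> B" for i j
      using M0[of i j] M0[of j i] separates_no_edge[OF G D that] that disj V by auto
    have AV: "A \<subseteq> V" "finite A" using V fin by auto
    \<comment> \<open>The eliminated part will be \<open>P\<close> and the remainder
      \<open>Q\<close>. Rows in \<open>B\<close> have no entries in columns of \<open>A\<close>, so
      \<open>P\<close> vanishes on them; \<open>Q\<close> vanishes on rows in \<open>A\<close>
      because elimination is exact there.\<close>
    obtain w where w: "psd_on V (\<lambda>i j. M i j - (\<Sum>s\<in>A. w s i * w s j))"
      "\<And>i j. i \<in> A \<Longrightarrow> j \<in> V \<Longrightarrow> M i j = (\<Sum>s\<in>A. w s i * w s j)"
      "\<And>i s. i \<in> V \<Longrightarrow> (\<forall>s\<in>A. M i s = 0) \<Longrightarrow> s \<in> A \<Longrightarrow> w s i = 0"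
      using psd_on_eliminate_set[OF AV(2) fin AV(1) psdM] by blast
    define P where "P i j = (\<Sum>s\<in>A. w s i * w s j)" for i j
    define Q where "Q i j = M i j - P i j" for i j
    have MPQ: "M i j = P i j + Q i j" for i j by (simp add: Q_def)
    have psdP: "psd_on V P"
      unfolding P_def[abs_def] by (intro psd_on_sum psd_on_rank1)
    have psdQ: "psd_on V Q" using w(1) unfolding Q_def[abs_def] P_def .
    have PB: "P i j = 0" if "i \<in> B \<or> j \<in> B" "i \<in> V" "j \<in> V" for i j
      using that w(3) MAB by (auto simp: P_def intro!: sum.neutral)
    have QA: "Q i j = 0" if "i \<in> A \<or> j \<in> A" "i \<in> V" "j \<in> V" for i j
      using that w(2)[of i j] w(2)[of j i] psd_on_sym[OF psdQ that(2,3)]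
      by (auto simp: P_def Q_def)
    have "psd_on (A \<union> C) (\<lambda>i j. f (P i j))"
    proof (rule A, unfold PG_iff, intro conjI ballI impI)
      show "psd_on (A \<union> C) P" by (rule psd_on_subset[OF fin _ psdP]) (use V in auto)
      fix i j assume ij: "i \<in> A \<union> C" "j \<in> A \<union> C" "i \<noteq> j \<and> \<not> E i j"
      then have "i \<in> A \<or> j \<in> A" using compl by (auto simp: is_complete_def)
      then show "P i j = 0" using QA[of i j] M0[of i j] MPQ[of i j] ij V by auto
    qed
    then have "psd_on V (\<lambda>i j. if i \<in> A \<union> C \<and> j \<in> A \<union> C then f (P i j) else 0)"
      by (rule psd_on_zero_extend[OF fin, rotated]) (use V in auto)
    moreover
    have "psd_on (B \<union> C) (\<lambda>i j. f (Q i j))"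
    proof (rule B, unfold PG_iff, intro conjI ballI impI)
      show "psd_on (B \<union> C) Q" by (rule psd_on_subset[OF fin _ psdQ]) (use V in auto)
      fix i j assume ij: "i \<in> B \<union> C" "j \<in> B \<union> C" "i \<noteq> j \<and> \<not> E i j"
      then have "i \<in> B \<or> j \<in> B" using compl by (auto simp: is_complete_def)
      then show "Q i j = 0" using PB[of i j] M0[of i j] MPQ[of i j] ij V by auto
    qed
    then have "psd_on V (\<lambda>i j. if i \<in> B \<union> C \<and> j \<in> B \<union> C then f (Q i j) else 0)"
      by (rule psd_on_zero_extend[OF fin, rotated]) (use V in auto)
    moreover
    have "psd_on C (\<lambda>i j. f (P i j + Q i j) - f (P i j) - f (Q i j))"
      by (rule C; rule psd_on_subset[OF fin]) (use V psdP psdQ in auto)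
    then have "psd_on V (\<lambda>i j. if i \<in> C \<and> j \<in> C then f (P i j + Q i j) - f (P i j) - f (Q i j) else 0)"
      by (rule psd_on_zero_extend[OF fin, rotated]) (use V in auto)
    \<comment> \<open>The sum is f[M]: on C x C the terms telescope, and elsewhere \<open>P\<close>
      or \<open>Q\<close> vanishes, where \<open>f 0 = 0\<close> is used.\<close>
    ultimately have "psd_on V (\<lambda>i j. (if i \<in> A \<union> C \<and> j \<in> A \<union> C then f (P i j) else 0)
        + (if i \<in> B \<union> C \<and> j \<in> B \<union> C then f (Q i j) else 0)
        + (if i \<in> C \<and> j \<in> C then f (P i j + Q i j) - f (P i j) - f (Q i j) else 0))"
      by (intro psd_on_add)
    then show ?thesis
    proof (rule psd_on_cong[THEN iffD1, rotated], goal_cases)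
      case (1 i j)
      then consider "i \<in> A \<or> j \<in> A" | "i \<in> B \<or> j \<in> B" | "i \<in> C" "j \<in> C" using V by blast
      then show ?case
      proof cases
        case 1
        then show ?thesis
          using QA[of i j] PB[of i j] \<open>i \<in> V\<close> \<open>j \<in> V\<close> V disj f0 by (auto simp: MPQ)
      next
        case 2
        then show ?thesis
          using QA[of i j] PB[of i j] \<open>i \<in> V\<close> \<open>j \<in> V\<close> V disj f0 by (auto simp: MPQ)
      next
        case 3
        then show ?thesis by (simp add: MPQ)
      qed
    qed
  qed
  then show ?thesis by (simp add: preserves_pos_iff f0)
qed

text \<open>Padding with zeros respects the pattern of the larger graph and commutes with
  \<open>f\<close> because \<open>f 0 = 0\<close>.\<close>

lemma preserves_pos_subset:
  assumes "finite V" "U \<subseteq> V" "f 0 = 0" "preserves_pos f E V"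
  shows "preserves_pos f E U"
  unfolding preserves_pos_iff[where f = f, OF assms(3)]
proof
  fix M assume "M \<in> PG E U"
  then have M: "psd_on U M" "\<And>i j. i \<in> U \<Longrightarrow> j \<in> U \<Longrightarrow> i \<noteq> j \<Longrightarrow> \<not> E i j \<Longrightarrow> M i j = 0"
    by (auto simp: PG_iff)
  let ?M = "\<lambda>i j. if i \<in> U \<and> j \<in> U then M i j else 0"
  have "psd_on V ?M"
    by (rule psd_on_zero_extend[OF assms(1,2) M(1)])
  then have "?M \<in> PG E V" using M(2) by (auto simp: PG_iff)
  then have "psd_on V (\<lambda>i j. f (?M i j))"
    using assms(3,4) by (simp add: preserves_pos_iff)
  then have "psd_on U (\<lambda>i j. f (?M i j))"
    by (rule psd_on_subset[OF assms(1,2)])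
  then show "psd_on U (\<lambda>i j. f (M i j))"
    by (rule psd_on_cong[THEN iffD1, rotated]) auto
qed

text \<open>The matrix \<open>a a\<^sup>T + b b\<^sup>T\<close> with \<open>a = e\<^sub>v\<^sub>1 + u\<close> and \<open>b = e\<^sub>v\<^sub>2 + v\<close> has the right zero pattern, and
  the Schur complement of \<open>v\<^sub>1, v\<^sub>2\<close> in its image is the super-additivity defect of \<open>u u\<^sup>T\<close> and \<open>v v\<^sup>T\<close>.\<close>

lemma preserves_pos_rank1_superadditive:
  assumes G: "simple_graph V E" and D: "decomposition V E A C B"
    and f: "is_power \<alpha> f" and pos: "preserves_pos f E V"
    and K: "K \<subseteq> C" and v1: "v1 \<in> A" "\<And>v. v \<in> K \<Longrightarrow> E v1 v" and v2: "v2 \<in> B" "\<And>v. v \<in> K \<Longrightarrow> E v2 v"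
  shows "rank1_superadditive f K"
  unfolding rank1_superadditive_def
proof (intro allI)
  fix u v x :: "'a \<Rightarrow> real"
  have fin: "finite V" using G by (simp add: simple_graph_def)
  have V: "V = A \<union> C \<union> B" and compl: "is_complete E K"
    and neq: "v1 \<noteq> v2" "v1 \<notin> K" "v2 \<notin> K"
    using D K v1(1) v2(1) by (auto simp: decomposition_def intro: is_complete_subset)
  define a where "a i = (if i = v1 then 1 else if i \<in> K then u i else 0)" for i
  define b where "b i = (if i = v2 then 1 else if i \<in> K then v i else 0)" for i
  define M where "M i j = a i * a j + b i * b j" for i j
  have E: "E v v1" "E v v2" if "v \<in> K" for v
    using v1 v2 that G by (auto simp: simple_graph_def)
  \<comment> \<open>Each of \<open>a\<close> and \<open>b\<close> is supported on a complete set,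
    \<open>K\<close> with one of the two vertices added.\<close>
  have "M i j = 0" if "i \<noteq> j" "\<not> E i j" for i j
  proof -
    have "a i * a j = 0"
    proof (rule ccontr)
      assume "a i * a j \<noteq> 0"
      then have "i = v1 \<or> i \<in> K" "j = v1 \<or> j \<in> K" by (auto simp: a_def split: if_splits)
      then show False using that compl v1 E by (auto simp: is_complete_def)
    qed
    moreover have "b i * b j = 0"
    proof (rule ccontr)
      assume "b i * b j \<noteq> 0"
      then have "i = v2 \<or> i \<in> K" "j = v2 \<or> j \<in> K" by (auto simp: b_def split: if_splits)
      then show False using that compl v2 E by (auto simp: is_complete_def)
    qed
    ultimately show ?thesis by (simp only: M_def add_0)
  qed
  moreover have "psd_on V M" unfolding M_def[abs_def] by (intro psd_on_add psd_on_rank1)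
  ultimately have "M \<in> PG E V" by (simp add: PG_iff)
  then have psd: "psd_on V (\<lambda>i j. f (M i j))"
    using pos f by (simp add: preserves_pos_iff)
  have finK: "finite K" and KV: "insert v1 (insert v2 K) \<subseteq> V"
    using V K v1 v2 fin by (auto intro: finite_subset)
  define p where "p = (\<Sum>i\<in>K. x i * f (u i))"
  define q where "q = (\<Sum>i\<in>K. x i * f (v i))"
  \<comment> \<open>The block of \<open>F\<close> on \<open>v1\<close>, \<open>v2\<close> is the
    identity, so these two entries minimise the form for given \<open>x\<close> on \<open>K\<close>
    and leave the form on \<open>K\<close> minus p^2 + q^2.\<close>
  define z where "z = (\<lambda>i. if i = v1 then - p else if i = v2 then - q else x i)"
  define F where "F i j = f (M i j)" for i j
  have f01: "f 0 = 0" "f 1 = 1" using f by simp_all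
  have F: "F v1 v1 = 1" "F v2 v2 = 1" "F v1 v2 = 0" "F v2 v1 = 0"
    "\<And>i. i \<in> K \<Longrightarrow> F v1 i = f (u i)" "\<And>i. i \<in> K \<Longrightarrow> F i v1 = f (u i)"
    "\<And>i. i \<in> K \<Longrightarrow> F v2 i = f (v i)" "\<And>i. i \<in> K \<Longrightarrow> F i v2 = f (v i)"
    "\<And>i j. i \<in> K \<Longrightarrow> j \<in> K \<Longrightarrow> F i j = f (u i * u j + v i * v j)"
    using neq f01 by (auto simp: F_def M_def a_def b_def)
  have z: "z v1 = - p" "z v2 = - q" "\<And>i. i \<in> K \<Longrightarrow> z i = x i"
    using neq by (auto simp: z_def)
  have "0 \<le> qform (insert v1 (insert v2 K)) F z"
    unfolding F_def by (intro psd_on_qform psd_on_subset[OF fin KV psd])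
  also have "\<dots> = qform K F z
      + (\<Sum>i\<in>K. z i * F i v1) * z v1 + (\<Sum>i\<in>K. z i * F i v2) * z v2
      + z v1 * (\<Sum>j\<in>K. F v1 j * z j) + z v2 * (\<Sum>j\<in>K. F v2 j * z j)
      + z v1 * F v1 v1 * z v1 + z v1 * F v1 v2 * z v2 + z v2 * F v2 v1 * z v1 + z v2 * F v2 v2 * z v2"
    using neq finK by (simp add: qform_def sum.distrib sum_distrib_left sum_distrib_right mult.assoc)
  also have "(\<Sum>i\<in>K. z i * F i v1) = p" unfolding p_def by (intro sum.cong) (simp_all add: F z)
  also have "(\<Sum>i\<in>K. z i * F i v2) = q" unfolding q_def by (intro sum.cong) (simp_all add: F z)
  also have "(\<Sum>j\<in>K. F v1 j * z j) = p" unfolding p_def by (intro sum.cong) (simp_all add: F z mult.commute)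
  also have "(\<Sum>j\<in>K. F v2 j * z j) = q" unfolding q_def by (intro sum.cong) (simp_all add: F z mult.commute)
  also have "qform K F z = qform K (\<lambda>i j. f (u i * u j + v i * v j)) x"
    unfolding qform_def by (intro sum.cong refl) (simp add: F z)
  finally show "(\<Sum>i\<in>K. x i * f (u i))\<^sup>2 + (\<Sum>i\<in>K. x i * f (v i))\<^sup>2
      \<le> qform K (\<lambda>i j. f (u i * u j + v i * v j)) x"
    by (simp add: F z power2_eq_square p_def[symmetric] q_def[symmetric])
qed

lemma preserves_pos_imp_superadditive:
  assumes G: "simple_graph V E" and D: "decomposition V E A C B"
    and f: "is_power \<alpha> f" and pos: "preserves_pos f E V"
    and K: "K \<subseteq> C" and v1: "v1 \<in> A" "\<forall>v\<in>K. E v1 v" and v2: "v2 \<in> B" "\<forall>v\<in>K. E v2 v"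
  shows "loewner_superadditive f E K"
proof -
  have compl: "is_complete E K" and KV: "K \<subseteq> V"
    using D K by (auto simp: decomposition_def intro: is_complete_subset)
  then have finK: "finite K" using G by (auto simp: simple_graph_def intro: finite_subset)
  have "rank1_superadditive f K"
    using preserves_pos_rank1_superadditive[OF G D f pos K v1(1) _ v2(1)] v1(2) v2(2) by blast
  then show ?thesis
    using rank1_superadditive_imp_superadditive[OF finK _ f] f
    by (simp add: loewner_superadditive_complete[where f = f, OF _ compl])
qed

section \<open>Separators consisting of a single vertex, and the final assembly\<close>

lemma psd_on_singleton: "psd_on {c} M \<longleftrightarrow> 0 \<le> M c c"
proof
  show "0 \<le> M c c" if "psd_on {c} M"
    using psd_on_qform[OF that, of "\<lambda>_. 1"] by (simp add: qform_def)
  assume "0 \<le> M c c"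
  then have "0 \<le> M c c * (t * t)" for t by simp
  then show "psd_on {c} M" by (simp add: psd_on_def mult_ac)
qed

lemma loewner_superadditive_singleton:
  assumes "f 0 = 0"
  shows "loewner_superadditive f E {c} \<longleftrightarrow> (\<forall>x\<ge>0. \<forall>y\<ge>0. f x + f y \<le> f (x + y))"
proof -
  have compl: "is_complete E {c}" by (simp add: is_complete_def)
  have "loewner_superadditive f E {c} \<longleftrightarrow>
      (\<forall>M N. 0 \<le> M c c \<longrightarrow> 0 \<le> N c c \<longrightarrow> 0 \<le> f (M c c + N c c) - f (M c c) - f (N c c))"
    by (simp only: loewner_superadditive_complete[where f = f, OF assms compl] psd_on_singleton)
  also have "\<dots> \<longleftrightarrow> (\<forall>x\<ge>0. \<forall>y\<ge>0. 0 \<le> f (x + y) - f x - f y)"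
  proof (intro iffI allI impI)
    fix x y :: real
    assume H: "\<forall>M N. 0 \<le> M c c \<longrightarrow> 0 \<le> N c c \<longrightarrow> 0 \<le> f (M c c + N c c) - f (M c c) - f (N c c)"
      and "0 \<le> x" "0 \<le> y"
    then show "0 \<le> f (x + y) - f x - f y"
      using H[rule_format, of "\<lambda>_ _. x" "\<lambda>_ _. y"] by simp
  qed simp
  finally show ?thesis by (simp add: algebra_simps)
qed

theorem theorem3p2:
  fixes V A B C :: "'a set" and E :: "'a \<Rightarrow> 'a \<Rightarrow> bool" and f :: "real \<Rightarrow> real"
  assumes "simple_graph V E" and "decomposition V E A C B"
  shows "(preserves_pos f E (A \<union> C) \<and> preserves_pos f E (B \<union> C)
            \<and> loewner_superadditive f E C \<longrightarrow> preserves_pos f E V)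
       \<and> ((\<exists>\<alpha>. f = psi \<alpha> \<or> f = phi \<alpha>) \<and> preserves_pos f E V \<longrightarrow>
            (\<forall>C'. C' \<subseteq> C \<and> is_clique V E C'
                  \<and> (\<exists>v1\<in>A. \<forall>v\<in>C'. E v1 v) \<and> (\<exists>v2\<in>B. \<forall>v\<in>C'. E v2 v)
                  \<longrightarrow> loewner_superadditive f E C'))
       \<and> ((\<exists>\<alpha>. f = psi \<alpha> \<or> f = phi \<alpha>) \<and> card C = 1
            \<and> (\<exists>v1\<in>A. \<forall>v\<in>C. E v1 v) \<and> (\<exists>v2\<in>B. \<forall>v\<in>C. E v2 v) \<longrightarrow>
            (preserves_pos f E V \<longleftrightarrow>
               preserves_pos f E (A \<union> C) \<and> preserves_pos f E (B \<union> C)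
               \<and> (\<forall>x\<ge>0. \<forall>y\<ge>0. f x + f y \<le> f (x + y))))"
proof (intro conjI impI)
  show "preserves_pos f E V"
    if "preserves_pos f E (A \<union> C) \<and> preserves_pos f E (B \<union> C) \<and> loewner_superadditive f E C"
    using preserves_pos_glue[OF assms] that by blast
next
  assume "(\<exists>\<alpha>. f = psi \<alpha> \<or> f = phi \<alpha>) \<and> preserves_pos f E V"
  then show "\<forall>C'. C' \<subseteq> C \<and> is_clique V E C'
      \<and> (\<exists>v1\<in>A. \<forall>v\<in>C'. E v1 v) \<and> (\<exists>v2\<in>B. \<forall>v\<in>C'. E v2 v) \<longrightarrow> loewner_superadditive f E C'"
    using preserves_pos_imp_superadditive[OF assms] unfolding is_power_def by blast
next
  assume *: "(\<exists>\<alpha>. f = psi \<alpha> \<or> f = phi \<alpha>) \<and> card C = 1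
      \<and> (\<exists>v1\<in>A. \<forall>v\<in>C. E v1 v) \<and> (\<exists>v2\<in>B. \<forall>v\<in>C. E v2 v)"
  then obtain \<alpha> where f: "is_power \<alpha> f" by (auto simp: is_power_def)
  obtain c where c: "C = {c}" using * by (auto simp: card_1_singleton_iff)
  have f0: "f 0 = 0" using f by simp
  have V: "finite V" "A \<union> C \<subseteq> V" "B \<union> C \<subseteq> V"
    using assms by (auto simp: simple_graph_def decomposition_def)
  have super: "loewner_superadditive f E C \<longleftrightarrow> (\<forall>x\<ge>0. \<forall>y\<ge>0. f x + f y \<le> f (x + y))"
    unfolding c by (rule loewner_superadditive_singleton[where f = f, OF f0])
  show "preserves_pos f E V \<longleftrightarrow> preserves_pos f E (A \<union> C) \<and> preserves_pos f E (B \<union> C)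
      \<and> (\<forall>x\<ge>0. \<forall>y\<ge>0. f x + f y \<le> f (x + y))"
    unfolding super[symmetric]
  proof (intro iffI conjI)
    assume pos: "preserves_pos f E V"
    show "preserves_pos f E (A \<union> C)" "preserves_pos f E (B \<union> C)"
      using preserves_pos_subset[where f = f, OF V(1) _ f0 pos] V by blast+
    \<comment> \<open>The converse part is applied to the whole separator, with its common
      neighbours in \<open>A\<close> and \<open>B\<close> taken from the assumption.\<close>
    show "loewner_superadditive f E C"
      using preserves_pos_imp_superadditive[OF assms f pos subset_refl] * by blast
  qed (use preserves_pos_glue[OF assms] in blast)
qed

end
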